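(* Let $p\ge 1$. Let $f=\sum_{j\in[k]}f(j)\in\mathbb{R}^n$ be defined by a distributed data stream $S$ over $k$ servers, let $\mathbf{e}_1,\ldots,\mathbf{e}_n$ be i.i.d. standard exponential random variables, and let $g\in\mathbb{R}^n$ be the scaled vector $g_i=\frac{f_i}{\mathbf{e}_i^{1/p}}$. There exists a distributed monitoring algorithm that, at all times, maintains a set $\mathsf{PL}\subseteq[n]$ of coordinates that contains the maximizer $\arg\max_{i}g_i$ and contains only coordinates $i$ with $g_i$ at least a $\frac14$-fraction of $\max_{i'}g_{i'}$. The algorithm succeeds with probability $1-\frac{1}{\mathrm{poly}(n)}$ and uses $(k+k^{p-1})\cdot\mathrm{polylog}(n)$ total bits of communication in expectation.
   Context: Distributed monitoring (coordinator) model: $k$ servers and a coordinator with private two-way channels; the stream (of length $\mathrm{poly}(n)$) consists of insertion updates, each incrementing one coordinate of $[n]$ at one server; $f(j)$ is server $j$'s local frequency vector and $f$ is the sum. The exponential random variables are shared randomness known to all servers. Communication cost is the total number of bits sent. A standard exponential random variable has density $e^{-x}$ on $x\ge0$. *)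

theory Defs
  imports "HOL-Probability.Probability" "HOL-Library.While_Combinator"
begin

text \<open>
  Servers are numbered \<open>0, \<dots>, k - 1\<close> and coordinates \<open>0, \<dots>, n - 1\<close>.  A stream is a list of
  updates; the update \<open>(j, i)\<close> increments coordinate \<open>i\<close> at server \<open>j\<close>.
\<close>

type_synonym stream_updates = "(nat \<times> nat) list"

definition streams_over :: "nat \<Rightarrow> nat \<Rightarrow> stream_updates set" where
  "streams_over n k = {S. set S \<subseteq> {..<k} \<times> {..<n}}"

definition local_freq :: "stream_updates \<Rightarrow> nat \<Rightarrow> nat \<Rightarrow> nat" where
  "local_freq S j i = count_list S (j, i)"

definition freq :: "nat \<Rightarrow> stream_updates \<Rightarrow> nat \<Rightarrow> nat" where
  "freq k S i = (\<Sum>j<k. local_freq S j i)"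

definition scaled_freq :: "real \<Rightarrow> nat \<Rightarrow> (nat \<Rightarrow> real) \<Rightarrow> stream_updates \<Rightarrow> nat \<Rightarrow> real" where
  "scaled_freq p k e S i = real (freq k S i) / e i powr (1 / p)"

definition valid_PL :: "nat \<Rightarrow> (nat \<Rightarrow> real) \<Rightarrow> nat set \<Rightarrow> bool" where
  "valid_PL n g PL \<longleftrightarrow>
     PL \<subseteq> {..<n} \<and>
     (\<forall>i. is_arg_max g (\<lambda>i. i < n) i \<longrightarrow> i \<in> PL) \<and>
     (\<forall>i\<in>PL. g i \<ge> 1 / 4 * Max (g ` {..<n}))"


text \<open>
  Protocols in the coordinator model.  A message is a bit string, and the empty string stands for
  not sending anything, so that every message that is sent costs at least one bit.  Each party acts
  only when it observes something: a server when it receives an update or a message of the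
  coordinator, the coordinator when it receives a message of a server.  What a party sends is an
  arbitrary function of the shared randomness, its own random tape, and everything it has observed
  so far, in this order.  There is no common clock, so silence carries no information.
\<close>

datatype observation = Update nat | Message "bool list"

record protocol =
  server_send :: "nat \<Rightarrow> (nat \<Rightarrow> real) \<Rightarrow> (nat \<Rightarrow> real) \<Rightarrow> observation list \<Rightarrow> bool list"
  coord_send :: "(nat \<Rightarrow> real) \<Rightarrow> (nat \<Rightarrow> real) \<Rightarrow> (nat \<times> bool list) list \<Rightarrow> nat \<Rightarrow> bool list"
  coord_out :: "(nat \<Rightarrow> real) \<Rightarrow> (nat \<Rightarrow> real) \<Rightarrow> (nat \<times> bool list) list \<Rightarrow> nat set"

text \<open>
  A sample point \<open>(e, r, s)\<close> consists of the shared exponential variables \<open>e\<close>, the private tapes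
  \<open>r j\<close> of the servers, and the private tape \<open>s\<close> of the coordinator.
\<close>

type_synonym sample = "(nat \<Rightarrow> real) \<times> (nat \<Rightarrow> nat \<Rightarrow> real) \<times> (nat \<Rightarrow> real)"

definition tape_measure :: "(nat \<Rightarrow> real) measure" where
  "tape_measure = (\<Pi>\<^sub>M t\<in>UNIV. uniform_measure lborel {0..1})"

definition randomness :: "nat \<Rightarrow> nat \<Rightarrow> sample measure" where
  "randomness n k =
     (\<Pi>\<^sub>M i\<in>{..<n}. density lborel (exponential_density 1))
     \<Otimes>\<^sub>M ((\<Pi>\<^sub>M j\<in>{..<k}. tape_measure) \<Otimes>\<^sub>M tape_measure)"


datatype packet = To_Coord nat "bool list" | To_Server nat "bool list"

fun payload :: "packet \<Rightarrow> bool list" where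
  "payload (To_Coord j b) = b"
| "payload (To_Server j b) = b"

record config =
  server_hist :: "nat \<Rightarrow> observation list"
  coord_hist :: "(nat \<times> bool list) list"
  in_transit :: "packet list"
  bits_sent :: nat

definition send :: "packet list \<Rightarrow> config \<Rightarrow> config" where
  "send ps c =
     (let qs = filter (\<lambda>q. payload q \<noteq> []) ps
      in c\<lparr>in_transit := in_transit c @ qs,
           bits_sent := bits_sent c + (\<Sum>q\<leftarrow>qs. length (payload q))\<rparr>)"

fun coord_sends :: "protocol \<Rightarrow> nat \<Rightarrow> sample \<Rightarrow> config \<Rightarrow> config" where
  "coord_sends P k (e, r, s) c =
     send (map (\<lambda>j. To_Server j (coord_send P e s (coord_hist c) j)) [0..<k]) c"

fun server_sends :: "protocol \<Rightarrow> sample \<Rightarrow> nat \<Rightarrow> config \<Rightarrow> config" where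
  "server_sends P (e, r, s) j c =
     send [To_Coord j (server_send P j e (r j) (server_hist c j))] c"

definition coord_observe ::
  "protocol \<Rightarrow> nat \<Rightarrow> sample \<Rightarrow> nat \<times> bool list \<Rightarrow> config \<Rightarrow> config" where
  "coord_observe P k \<omega> m c = coord_sends P k \<omega> (c\<lparr>coord_hist := coord_hist c @ [m]\<rparr>)"

definition server_observe ::
  "protocol \<Rightarrow> sample \<Rightarrow> nat \<Rightarrow> observation \<Rightarrow> config \<Rightarrow> config" where
  "server_observe P \<omega> j x c =
     server_sends P \<omega> j (c\<lparr>server_hist := (server_hist c)(j := server_hist c j @ [x])\<rparr>)"

definition deliver :: "protocol \<Rightarrow> nat \<Rightarrow> sample \<Rightarrow> config \<Rightarrow> config" where
  "deliver P k \<omega> c =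
     (case in_transit c of
        [] \<Rightarrow> c
      | To_Coord j b # qs \<Rightarrow> coord_observe P k \<omega> (j, b) (c\<lparr>in_transit := qs\<rparr>)
      | To_Server j b # qs \<Rightarrow> server_observe P \<omega> j (Message b) (c\<lparr>in_transit := qs\<rparr>))"

text \<open>
  Messages are delivered in the order in which they were sent, until none is in transit; the value
  \<open>None\<close> means that the exchange never ends.
\<close>

definition settle :: "protocol \<Rightarrow> nat \<Rightarrow> sample \<Rightarrow> config \<Rightarrow> config option" where
  "settle P k \<omega> = while_option (\<lambda>c. in_transit c \<noteq> []) (deliver P k \<omega>)"

definition blank_config :: config where
  "blank_config = \<lparr>server_hist = (\<lambda>_. []), coord_hist = [], in_transit = [], bits_sent = 0\<rparr>"

text \<open>
  Before the first update the coordinator may send messages (an initialisation phase).  All messages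
  triggered by an update are exchanged before the next update arrives.
\<close>

definition process_update ::
  "protocol \<Rightarrow> nat \<Rightarrow> sample \<Rightarrow> config option \<Rightarrow> nat \<times> nat \<Rightarrow> config option" where
  "process_update P k \<omega> co u =
     Option.bind co (\<lambda>c. settle P k \<omega> (server_observe P \<omega> (fst u) (Update (snd u)) c))"

definition run :: "protocol \<Rightarrow> nat \<Rightarrow> sample \<Rightarrow> stream_updates \<Rightarrow> config option" where
  "run P k \<omega> S =
     foldl (process_update P k \<omega>) (settle P k \<omega> (coord_sends P k \<omega> blank_config)) S"

fun correct_now :: "real \<Rightarrow> nat \<Rightarrow> nat \<Rightarrow> protocol \<Rightarrow> stream_updates \<Rightarrow> sample \<Rightarrow> bool" where
  "correct_now p n k P S (e, r, s) =
     (case run P k (e, r, s) S of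
        None \<Rightarrow> False
      | Some c \<Rightarrow> valid_PL n (scaled_freq p k e S) (coord_out P e s (coord_hist c)))"

definition correct_always :: "real \<Rightarrow> nat \<Rightarrow> nat \<Rightarrow> protocol \<Rightarrow> stream_updates \<Rightarrow> sample \<Rightarrow> bool" where
  "correct_always p n k P S \<omega> \<longleftrightarrow> (\<forall>t\<le>length S. correct_now p n k P (take t S) \<omega>)"

text \<open>An exchange that never ends sends infinitely many bits, as every packet is nonempty.\<close>

definition total_bits :: "nat \<Rightarrow> protocol \<Rightarrow> stream_updates \<Rightarrow> sample \<Rightarrow> ennreal" where
  "total_bits k P S \<omega> =
     (case run P k \<omega> S of None \<Rightarrow> \<infinity> | Some c \<Rightarrow> of_nat (bits_sent c))"

end

(*
Let w_i = e_i^(-1/p), so that g_i = w_i f_i.  The coordinator maintains a level T = base * 2^a that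
follows max g up to a constant factor.  Each unit increment of coordinate i at a server is
reported with probability min(1, w_i Lam / T), provided that the server's local count v satisfies
v w_i >= T / (32 k); the units excluded by this condition have total mass at most T / 32.  A Chernoff
bound makes the rescaled report counts accurate up to a small fraction of g_i + T, for every time,
coordinate and level, where Lam is a multiple of log n.

For the communication, let H be the sum of f_i(j)^p over all servers and coordinates, which is at most
the sum of the f_i^p.  By independence of the exponentials, max g < x has probability at most
exp (-H / x^p), so T is at least about tau = (H / log n)^(1/p), a bound that depends on the stream only.
A unit is then reported with probability at most (Lam / tau) * E[e^(-1/p); e^(1/p) <= 32 k v / tau],
which is about k^(p-1) v^(p-1) / H up to logarithms.  As v^(p-1) is at most the increase of H, the sum
over the stream telescopes to log H.  Each of the O(log n) level changes costs O(k log n) bits.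
*)

theory Submission
  imports Defs
begin

section \<open>The protocol\<close>

text \<open>The obstacle is adaptivity: \<open>T\<close> depends on earlier reports, so the counts
  at the levels actually visited are not sums of independent variables. The test therefore compares
  one fixed uniform variable per unit with a bound that decreases in the level. For each fixed level
  the set of passing units is then a function of the exponentials and tapes alone, with a binomial
  count once the exponentials are fixed; all these counts are made accurate together, and the random
  level is substituted only afterwards. A report states how many levels its unit survives, which
  lets the coordinator recount under a new level.

  The cutoff \<open>v w_i >= T / (32 k)\<close> is there for the cost. Without it a unit is reported
  with probability about \<open>Lam E[e^(-1/p)] / tau\<close>, summing to order
  \<open>length S / tau\<close>; for \<open>p > 1\<close> and a stream touching each coordinate once
  this is \<open>n^(1 - 1/p)\<close> up to logarithms. With it, a unit of small local count
  qualifies only if its exponential is small.\<close>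

text \<open>The level is sent in unary, so a server, whose observations are given last first, reads it off the last message.\<close>

fun observed_level :: "observation list \<Rightarrow> nat" where
  "observed_level [] = 0"
| "observed_level (x # xs) = (case x of Update i \<Rightarrow> observed_level xs | Message b \<Rightarrow> length b)"

text \<open>\<open>Lam\<close> is the oversampling factor, \<open>base\<close> the lowest threshold,
  \<open>A\<close> the number of usable levels and \<open>L\<close> the common bit length of
  reports. They stay abstract until the failure and cost bounds are available as formulas in
  them.\<close>

locale tracker =
  fixes p Lam base :: real and n k A L :: nat and enc :: "nat \<times> nat \<Rightarrow> bool list"
  assumes p_ge_1: "p \<ge> 1" and Lam_pos: "Lam > 0" and base_pos: "base > 0"
    and n_ge_2: "n \<ge> 2" and k_ge_1: "k \<ge> 1" and A_pos: "A > 0" and L_pos: "L > 0"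
    and inj_enc: "inj_on enc ({..<n} \<times> {..A})" and length_enc [simp]: "length (enc x) = L"
begin

lemma enc_not_Nil [simp]: "enc x \<noteq> []"
  using L_pos length_enc[of x] by (metis list.size(3) less_irrefl)

definition weight :: "(nat \<Rightarrow> real) \<Rightarrow> nat \<Rightarrow> real" where
  "weight e i = 1 / e i powr (1 / p)"

definition thr :: "nat \<Rightarrow> real" where
  "thr a = base * 2 ^ a"

text \<open>
  A unit of coordinate \<open>i\<close> at a server, the one that raises the local count to \<open>v\<close>, carries its own
  uniform variable \<open>u\<close>; units below the second threshold are never reported, and over all \<open>k\<close>
  servers they carry a mass of at most \<open>thr a / 32\<close>.  The predicate is antitone in the level \<open>a\<close>, so
  the reports made at low levels remain exactly the ones needed at higher levels and nothing has to
  be sent again when the level rises.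
\<close>

definition kept :: "(nat \<Rightarrow> real) \<Rightarrow> real \<Rightarrow> nat \<Rightarrow> nat \<Rightarrow> nat \<Rightarrow> bool" where
  "kept e u i v a \<longleftrightarrow> u \<le> weight e i * Lam / thr a \<and> thr a \<le> 32 * real k * (real v * weight e i)"

definition kept_levels :: "(nat \<Rightarrow> real) \<Rightarrow> real \<Rightarrow> nat \<Rightarrow> nat \<Rightarrow> nat" where
  "kept_levels e u i v = card {a. a < A \<and> kept e u i v a}"

text \<open>By nestedness, a reported unit is kept at level \<open>a\<close> iff \<open>a\<close> is less than the transmitted number of levels.\<close>

definition msg_count :: "(nat \<times> bool list) list \<Rightarrow> nat \<Rightarrow> nat \<Rightarrow> nat" where
  "msg_count h i a = length (filter (\<lambda>m. \<exists>b. a < b \<and> b \<le> A \<and> snd m = enc (i, b)) h)"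

text \<open>The weight of a unit divided by its sampling probability \<open>min 1 (weight e i * Lam / thr a)\<close>.\<close>

definition unit_mass :: "(nat \<Rightarrow> real) \<Rightarrow> nat \<Rightarrow> nat \<Rightarrow> real" where
  "unit_mass e i a = max (weight e i) (thr a / Lam)"

definition est :: "(nat \<Rightarrow> real) \<Rightarrow> (nat \<times> bool list) list \<Rightarrow> nat \<Rightarrow> nat \<Rightarrow> real" where
  "est e h i a = real (msg_count h i a) * unit_mass e i a"

text \<open>Thresholds double, so a failed test one level below exhibits an estimate, taken at that
  lower level, of at least the current \<open>thr\<close>, while the passed test bounds all current
  estimates by twice the current \<open>thr\<close>.\<close>

definition level :: "(nat \<Rightarrow> real) \<Rightarrow> (nat \<times> bool list) list \<Rightarrow> nat" where
  "level e h = (LEAST a. \<forall>i<n. est e h i a < 2 * thr a)"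

text \<open>\<open>prod_encode\<close> gives each unit, named by coordinate and local count, its own
  cell of the server's tape, so distinct units use independent uniform variables.\<close>

definition server_msg :: "(nat \<Rightarrow> real) \<Rightarrow> (nat \<Rightarrow> real) \<Rightarrow> nat \<Rightarrow> nat \<Rightarrow> nat \<Rightarrow> bool list" where
  "server_msg e u i v a =
     (if kept e (u (prod_encode (i, v))) i v a then enc (i, kept_levels e (u (prod_encode (i, v))) i v) else [])"

text \<open>Comparing with \<open>butlast h\<close> detects that the latest report raised the level.
  A raised level is positive, so its unary code is never the empty string that means silence; level
  \<open>0\<close> needs no announcement, as all parties start there. The factor 1/2 in the output
  absorbs the estimation errors.\<close>

definition tracking_protocol :: protocol where
  "tracking_protocol =
     \<lparr>server_send = (\<lambda>j e u xs.
        (case rev xs of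
           Update i # _ \<Rightarrow> server_msg e u i (count_list xs (Update i)) (observed_level (rev xs))
         | _ \<Rightarrow> [])),
      coord_send = (\<lambda>e s h j. if level e h = level e (butlast h) then [] else replicate (level e h) True),
      coord_out = (\<lambda>e s h. {i. i < n \<and> (\<forall>i'<n. est e h i (level e h) \<ge> est e h i' (level e h) / 2)})\<rparr>"

lemma thr_pos [simp]: "thr a > 0"
  using base_pos by (simp add: thr_def)

lemma thr_Suc: "thr (Suc a) = 2 * thr a"
  by (simp add: thr_def)

lemma thr_mono: "a \<le> b \<Longrightarrow> thr a \<le> thr b"
  using base_pos by (simp add: thr_def)

lemma weight_nonneg [simp]: "weight e i \<ge> 0"
  by (simp add: weight_def)

lemma unit_mass_pos: "unit_mass e i a > 0"
  using Lam_pos by (simp add: unit_mass_def less_max_iff_disj)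

lemma kept_antimono:
  assumes "kept e u i v b" "a \<le> b"
  shows "kept e u i v a"
proof -
  have "weight e i * Lam / thr b \<le> weight e i * Lam / thr a"
    using thr_mono[OF assms(2)] Lam_pos by (intro divide_left_mono) auto
  then show ?thesis
    using assms thr_mono[OF assms(2)] unfolding kept_def by linarith
qed

lemma kept_levels_le: "kept_levels e u i v \<le> A"
  unfolding kept_levels_def using card_mono[of "{..<A}" "{a. a < A \<and> kept e u i v a}"] by auto

text \<open>By antitonicity the kept levels form an initial segment, whose cardinality is its
  length.\<close>

lemma less_kept_levels_iff:
  assumes "a < A"
  shows "a < kept_levels e u i v \<longleftrightarrow> kept e u i v a"
proof
  assume "kept e u i v a"
  then have "{..a} \<subseteq> {a. a < A \<and> kept e u i v a}"
    using assms kept_antimono by auto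
  from card_mono[OF _ this] show "a < kept_levels e u i v"
    by (simp add: kept_levels_def)
next
  assume less: "a < kept_levels e u i v"
  show "kept e u i v a"
  proof (rule ccontr)
    assume "\<not> kept e u i v a"
    then have "{b. b < A \<and> kept e u i v b} \<subseteq> {..<a}"
      using kept_antimono by (force simp: not_le[symmetric])
    from card_mono[OF _ this] less show False
      by (simp add: kept_levels_def)
  qed
qed

text \<open>A report counts at level \<open>a\<close> only if its code lies strictly above
  \<open>a\<close> and is at most \<open>A\<close>, so every estimate vanishes at \<open>A\<close>.
  This sentinel makes the \<open>LEAST\<close> in \<open>level\<close> well defined.\<close>

lemma level_ex: "\<forall>i<n. est e h i A < 2 * thr A"
  by (simp add: est_def msg_count_def)

lemma level_le: "level e h \<le> A"
  unfolding level_def by (rule Least_le) (rule level_ex)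

lemma est_less_at_level: "i < n \<Longrightarrow> est e h i (level e h) < 2 * thr (level e h)"
  using LeastI[of "\<lambda>a. \<forall>i<n. est e h i a < 2 * thr a", OF level_ex]
  unfolding level_def by blast

lemma est_ge_below_level: "a < level e h \<Longrightarrow> \<exists>i<n. est e h i a \<ge> 2 * thr a"
  using not_less_Least[of a "\<lambda>a. \<forall>i<n. est e h i a < 2 * thr a"]
  unfolding level_def by (force simp: not_less)

lemma level_Nil [simp]: "level e [] = 0"
  unfolding level_def by (rule Least_eq_0) (simp add: est_def msg_count_def)

lemma est_mono: "est e h i a \<le> est e (h @ h') i a"
  using unit_mass_pos[of e i a] by (simp add: est_def msg_count_def mult_right_mono)

text \<open>Further reports only raise the estimates, so a level that qualifies for the longer
  history qualifies for the shorter one.\<close>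

lemma level_mono: "level e h \<le> level e (h @ h')"
  unfolding level_def[of e h]
  by (rule Least_le) (meson est_less_at_level est_mono le_less_trans)

section \<open>The coordinator's history as a function of exponentials and tapes\<close>

fun rev_hist :: "(nat \<Rightarrow> real) \<Rightarrow> (nat \<Rightarrow> nat \<Rightarrow> real) \<Rightarrow> stream_updates \<Rightarrow> (nat \<times> bool list) list" where
  "rev_hist e r [] = []"
| "rev_hist e r (u # us) =
     (let m = server_msg e (r (fst u)) (snd u) (Suc (count_list us u)) (level e (rev_hist e r us))
      in if m = [] then rev_hist e r us else rev_hist e r us @ [(fst u, m)])"

text \<open>A message depends on the updates before it, hence the recursion that peels off the
  newest update first. No configuration or delivery order enters.\<close>

definition hist :: "(nat \<Rightarrow> real) \<Rightarrow> (nat \<Rightarrow> nat \<Rightarrow> real) \<Rightarrow> stream_updates \<Rightarrow> (nat \<times> bool list) list" where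
  "hist e r S = rev_hist e r (rev S)"

definition sends :: "(nat \<Rightarrow> real) \<Rightarrow> (nat \<Rightarrow> nat \<Rightarrow> real) \<Rightarrow> stream_updates \<Rightarrow> nat \<times> nat \<Rightarrow> bool" where
  "sends e r S u \<longleftrightarrow>
     kept e (r (fst u) (prod_encode (snd u, Suc (count_list S u)))) (snd u) (Suc (count_list S u))
       (level e (hist e r S))"

lemma hist_Nil [simp]: "hist e r [] = []"
  by (simp add: hist_def)

lemma hist_snoc:
  "hist e r (S @ [u]) = hist e r S @
     (if sends e r S u
      then [(fst u, enc (snd u, kept_levels e (r (fst u) (prod_encode (snd u, Suc (count_list S u)))) (snd u)
                               (Suc (count_list S u))))]
      else [])"
  by (simp add: hist_def sends_def server_msg_def Let_def)

definition bits :: "(nat \<Rightarrow> real) \<Rightarrow> (nat \<times> bool list) list \<Rightarrow> nat" where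
  "bits e h = (\<Sum>t<length h. length (snd (h ! t)) +
     (if level e (take (Suc t) h) = level e (take t h) then 0 else k * level e (take (Suc t) h)))"

lemma bits_snoc:
  "bits e (h @ [m]) = bits e h + length (snd m) +
     (if level e (h @ [m]) = level e h then 0 else k * level e (h @ [m]))"
  by (auto simp: bits_def nth_append intro!: sum.cong)

text \<open>An amortisation: each broadcast costs at most \<open>k * A\<close> bits and comes with a
  rise of the level by at least one, so the potential \<open>k * A * level e h\<close> pays for all
  broadcasts.\<close>

lemma bits_le:
  assumes "\<forall>m\<in>set h. length (snd m) = L"
  shows "bits e h \<le> L * length h + k * A * level e h"
  using assms
proof (induction h rule: rev_induct)
  case (snoc m h)
  show ?case
  proof (cases "level e (h @ [m]) = level e h")
    case False
    then have "Suc (level e h) \<le> level e (h @ [m])"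
      using level_mono[of e h "[m]"] by simp
    then have "k * A * Suc (level e h) \<le> k * A * level e (h @ [m])"
      by (intro mult_left_mono) auto
    moreover have "k * level e (h @ [m]) \<le> k * A"
      by (rule mult_left_mono[OF level_le]) simp
    moreover have "bits e h \<le> L * length h + k * A * level e h"
      using snoc by simp
    moreover have "bits e (h @ [m]) = bits e h + L + k * level e (h @ [m])"
      using snoc False by (simp add: bits_snoc)
    moreover have "k * A * Suc (level e h) = k * A + k * A * level e h" "L * length (h @ [m]) = L + L * length h"
      by simp_all
    ultimately show ?thesis
      by linarith
  qed (use snoc in \<open>simp add: bits_snoc\<close>)
qed (simp add: bits_def)

lemma set_hist: "m \<in> set (hist e r S) \<Longrightarrow> length (snd m) = L"
  by (induction S rule: rev_induct) (auto simp: hist_snoc split: if_splits)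

section \<open>Agreement of the operational run with this function\<close>

lemma server_send_Message [simp]: "server_send tracking_protocol j e u (xs @ [Message b]) = []"
  by (simp add: tracking_protocol_def)

lemma server_observe_Message:
  "server_observe tracking_protocol \<omega> j (Message b) c =
     c\<lparr>server_hist := (server_hist c)(j := server_hist c j @ [Message b])\<rparr>"
  by (cases \<omega>) (simp add: server_observe_def send_def)

lemma settle_idle: "in_transit c = [] \<Longrightarrow> settle P k \<omega> c = Some c"
  unfolding settle_def by (subst while_option_unfold) simp

text \<open>Servers never answer a message, so the queue only drains.\<close>

lemma settle_broadcast:
  assumes "distinct js" "in_transit c = map (\<lambda>j. To_Server j b) js"
  shows "settle tracking_protocol k \<omega> c = Some (c\<lparr>in_transit := [],
     server_hist := (\<lambda>j. if j \<in> set js then server_hist c j @ [Message b] else server_hist c j)\<rparr>)"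
  using assms
proof (induction js arbitrary: c)
  case Nil
  then show ?case
    by (auto intro!: settle_idle[THEN trans])
next
  case (Cons j js)
  let ?c = "deliver tracking_protocol k \<omega> c"
  have c: "?c = c\<lparr>in_transit := map (\<lambda>j. To_Server j b) js,
      server_hist := (server_hist c)(j := server_hist c j @ [Message b])\<rparr>"
    using Cons.prems by (simp add: deliver_def server_observe_Message)
  have "settle tracking_protocol k \<omega> c = settle tracking_protocol k \<omega> ?c"
    unfolding settle_def using Cons.prems by (subst while_option_unfold) simp
  also have "\<dots> = Some (?c\<lparr>in_transit := [],
     server_hist := (\<lambda>j. if j \<in> set js then server_hist ?c j @ [Message b] else server_hist ?c j)\<rparr>)"
    using Cons.prems by (intro Cons.IH) (auto simp: c)
  also have "\<dots> = Some (c\<lparr>in_transit := [],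
     server_hist := (\<lambda>i. if i \<in> set (j # js) then server_hist c i @ [Message b] else server_hist c i)\<rparr>)"
    using Cons.prems by (auto simp: c fun_eq_iff)
  finally show ?case .
qed

lemma observed_level_snoc [simp]:
  "observed_level (rev (xs @ [Message b])) = length b"
  "observed_level (rev (xs @ [Update i])) = observed_level (rev xs)"
  by simp_all

text \<open>The invariant that replaces the operational semantics by \<open>hist\<close> and
  \<open>bits\<close>. Between updates every server can read the current level and its own counts
  off its observations, so its next message is the one computed in \<open>rev_hist\<close>.\<close>

lemma run_Some:
  assumes "set S \<subseteq> {..<k} \<times> {..<n}"
  shows "\<exists>c. run tracking_protocol k (e, r, s) S = Some c \<and> in_transit c = [] \<and>
     coord_hist c = hist e r S \<and> bits_sent c = bits e (hist e r S) \<and>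
     (\<forall>j<k. observed_level (rev (server_hist c j)) = level e (hist e r S) \<and>
            (\<forall>i. count_list (server_hist c j) (Update i) = count_list S (j, i)))"
  using assms
proof (induction S rule: rev_induct)
  case Nil
  have "coord_sends tracking_protocol k (e, r, s) blank_config = blank_config"
    by (simp add: send_def blank_config_def tracking_protocol_def)
  moreover have "settle tracking_protocol k (e, r, s) blank_config = Some blank_config"
    by (rule settle_idle) (simp add: blank_config_def)
  ultimately show ?case
    by (simp add: run_def) (simp add: blank_config_def bits_def)
next
  case (snoc u S)
  then obtain c where c: "run tracking_protocol k (e, r, s) S = Some c" "in_transit c = []"
     "coord_hist c = hist e r S" "bits_sent c = bits e (hist e r S)"
     "\<And>j. j < k \<Longrightarrow> observed_level (rev (server_hist c j)) = level e (hist e r S)"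
     "\<And>j i. j < k \<Longrightarrow> count_list (server_hist c j) (Update i) = count_list S (j, i)"
    by auto
  obtain j i where u: "u = (j, i)" "j < k" "i < n"
    using snoc.prems by (cases u) auto
  define c' where "c' = c\<lparr>server_hist := (server_hist c)(j := server_hist c j @ [Update i])\<rparr>"
  define m where "m = server_msg e (r j) i (Suc (count_list S u)) (level e (hist e r S))"
  have hist: "hist e r (S @ [u]) = (if m = [] then hist e r S else hist e r S @ [(j, m)])"
    by (simp add: hist_def m_def u Let_def)
  have send: "server_send tracking_protocol j e (r j) (server_hist c j @ [Update i]) = m"
    using c u by (simp add: tracking_protocol_def m_def)
  have run: "run tracking_protocol k (e, r, s) (S @ [u]) =
      settle tracking_protocol k (e, r, s) (send [To_Coord j m] c')"
    using c(1) by (simp add: run_def process_update_def server_observe_def send u c'_def[symmetric])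
  show ?case
  proof (cases "m = []")
    case True
    then have "run tracking_protocol k (e, r, s) (S @ [u]) = Some c'"
      using c(2) by (simp add: run send_def settle_idle c'_def)
    with True c u show ?thesis
      by (auto simp: hist[unfolded u(1)] c'_def)
  next
    case False
    let ?h = "hist e r S @ [(j, m)]"
    let ?js = "if level e ?h = level e (hist e r S) then [] else [0..<k]"
    let ?b = "replicate (level e ?h) True"
    let ?c1 = "c'\<lparr>in_transit := [To_Coord j m], bits_sent := bits_sent c + length m\<rparr>"
    let ?c2 = "deliver tracking_protocol k (e, r, s) ?c1"
    \<comment> \<open>Without this, \<open>send\<close> would discard the broadcast as
      silence.\<close>
    have b: "?b \<noteq> []" if "level e ?h \<noteq> level e (hist e r S)"
      using level_mono[of e "hist e r S" "[(j, m)]"] that by auto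
    have coord: "coord_send tracking_protocol e s ?h = (\<lambda>j.
        if level e ?h = level e (hist e r S) then [] else ?b)"
      by (simp add: tracking_protocol_def)
    have c2: "?c2 = c'\<lparr>in_transit := map (\<lambda>j. To_Server j ?b) ?js, coord_hist := ?h,
                bits_sent := bits e ?h\<rparr>"
    proof (cases "level e ?h = level e (hist e r S)")
      case True
      then show ?thesis
        using c by (simp add: deliver_def coord_observe_def c'_def send_def coord bits_snoc)
    next
      case ne: False
      have "filter (\<lambda>q. payload q \<noteq> []) (map (\<lambda>j. To_Server j ?b) [0..<k]) = map (\<lambda>j. To_Server j ?b) [0..<k]"
        using b[OF ne] by (auto simp: filter_id_conv)
      moreover have "(\<Sum>q\<leftarrow>map (\<lambda>j. To_Server j ?b) [0..<k]. length (payload q)) = k * level e ?h"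
        by (simp add: o_def sum_list_triv)
      ultimately show ?thesis
        using c ne by (simp add: deliver_def coord_observe_def c'_def send_def coord bits_snoc Let_def del: replicate_empty)
    qed
    have "run tracking_protocol k (e, r, s) (S @ [u]) = settle tracking_protocol k (e, r, s) ?c1"
      using c(2) False by (simp add: run send_def c'_def)
    also have "\<dots> = settle tracking_protocol k (e, r, s) ?c2"
      unfolding settle_def by (subst while_option_unfold) simp
    also have "\<dots> = Some (?c2\<lparr>in_transit := [],
        server_hist := (\<lambda>j. if j \<in> set ?js then server_hist ?c2 j @ [Message ?b] else server_hist ?c2 j)\<rparr>)"
      by (intro settle_broadcast) (auto simp: c2)
    finally show ?thesis
      unfolding c2 using c u False by (auto simp: hist[unfolded u(1)] c'_def)
  qed
qed

end

section \<open>Correctness on accurate samples\<close>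

context tracker
begin

text \<open>The number of reports that would be made if level \<open>a\<close> had been in force
  from the start. It ignores the actual course of the level, so for fixed \<open>e\<close> it is a
  sum of independent indicators.\<close>

definition kept_count :: "(nat \<Rightarrow> real) \<Rightarrow> (nat \<Rightarrow> nat \<Rightarrow> real) \<Rightarrow> stream_updates \<Rightarrow> nat \<Rightarrow> nat \<Rightarrow> nat" where
  "kept_count e r S i a =
     (\<Sum>j<k. card {v\<in>{1..count_list S (j, i)}. kept e (r j (prod_encode (i, v))) i v a})"

definition eligible :: "(nat \<Rightarrow> real) \<Rightarrow> nat \<Rightarrow> nat \<Rightarrow> nat \<Rightarrow> bool" where
  "eligible e i a v \<longleftrightarrow> thr a \<le> 32 * real k * (real v * weight e i)"

definition eligible_count :: "(nat \<Rightarrow> real) \<Rightarrow> stream_updates \<Rightarrow> nat \<Rightarrow> nat \<Rightarrow> nat" where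
  "eligible_count e S i a = (\<Sum>j<k. card {v\<in>{1..count_list S (j, i)}. eligible e i a v})"

definition accurate :: "(nat \<Rightarrow> real) \<Rightarrow> (nat \<Rightarrow> nat \<Rightarrow> real) \<Rightarrow> stream_updates \<Rightarrow> nat \<Rightarrow> nat \<Rightarrow> bool" where
  "accurate e r S i a \<longleftrightarrow>
     \<bar>real (kept_count e r S i a) * unit_mass e i a - real (eligible_count e S i a) * weight e i\<bar>
       \<le> (real (eligible_count e S i a) * weight e i + thr a) / 32"

definition all_accurate :: "(nat \<Rightarrow> real) \<Rightarrow> (nat \<Rightarrow> nat \<Rightarrow> real) \<Rightarrow> stream_updates \<Rightarrow> bool" where
  "all_accurate e r S \<longleftrightarrow> (\<forall>i<n. \<forall>a<A. accurate e r S i a)"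

text \<open>The first bound places level \<open>0\<close> no higher than any scaled frequency that
  occurs; the second keeps the sentinel level \<open>A\<close> out of reach.\<close>

definition in_range :: "(nat \<Rightarrow> real) \<Rightarrow> stream_updates \<Rightarrow> bool" where
  "in_range e S \<longleftrightarrow> (\<forall>i<n. base \<le> weight e i \<and> real (length S) * weight e i \<le> thr A / 2)"

lemma scaled_freq_eq: "scaled_freq p k e S i = real (freq k S i) * weight e i"
  by (simp add: scaled_freq_def weight_def)

lemma freq_snoc: "fst u < k \<Longrightarrow> freq k (S @ [u]) i = freq k S i + (if snd u = i then 1 else 0)"
proof -
  assume "fst u < k"
  then have "freq k (S @ [u]) i = (\<Sum>j<k. count_list S (j, i) + (if j = fst u then if snd u = i then 1 else 0 else 0))"
    unfolding freq_def local_freq_def by (intro sum.cong) (auto simp: prod_eq_iff)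
  with \<open>fst u < k\<close> show ?thesis
    by (simp add: sum.distrib freq_def local_freq_def)
qed

lemma freq_le_length: "set S \<subseteq> {..<k} \<times> {..<n} \<Longrightarrow> freq k S i \<le> length S"
proof (induction S rule: rev_induct)
  case (snoc u S)
  then show ?case
    using freq_snoc[of u S i] by auto
qed (simp add: freq_def local_freq_def)

lemma kept_count_snoc:
  assumes "j < k"
  shows "kept_count e r (S @ [(j, i')]) i a = kept_count e r S i a +
     (if i' = i \<and> kept e (r j (prod_encode (i, Suc (count_list S (j, i))))) i (Suc (count_list S (j, i))) a
      then 1 else 0)"
proof -
  let ?K = "\<lambda>j v. kept e (r j (prod_encode (i, v))) i v a"
  let ?new = "if i' = i \<and> ?K j (Suc (count_list S (j, i))) then 1 else (0::nat)"
  have "card {v\<in>{1..count_list (S @ [(j, i')]) (j', i)}. ?K j' v} =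
      card {v\<in>{1..count_list S (j', i)}. ?K j' v} + (if j' = j then ?new else 0)" for j'
  proof (cases "j' = j \<and> i' = i")
    case True
    then have "{v\<in>{1..count_list (S @ [(j, i')]) (j', i)}. ?K j' v} =
       {v\<in>{1..count_list S (j, i)}. ?K j v} \<union> {v\<in>{Suc (count_list S (j, i))}. ?K j v}"
      by auto
    moreover have "card ({v\<in>{1..count_list S (j, i)}. ?K j v} \<union> {v\<in>{Suc (count_list S (j, i))}. ?K j v}) =
       card {v\<in>{1..count_list S (j, i)}. ?K j v} + card {v\<in>{Suc (count_list S (j, i))}. ?K j v}"
      by (intro card_Un_disjoint) auto
    moreover have "{v\<in>{x}. Q v} = (if Q x then {x} else {})" for Q :: "nat \<Rightarrow> bool" and x
      by auto
    ultimately show ?thesis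
      using True by simp
  qed auto
  then show ?thesis
    using assms by (simp add: kept_count_def sum.distrib)
qed

lemma msg_count_enc:
  assumes "i < n" "i' < n" "b \<le> A"
  shows "msg_count (h @ [(j, enc (i', b))]) i a = msg_count h i a + (if i' = i \<and> a < b then 1 else 0)"
proof -
  have "(\<exists>c. a < c \<and> c \<le> A \<and> enc (i', b) = enc (i, c)) \<longleftrightarrow> i' = i \<and> a < b"
    using inj_onD[OF inj_enc] assms by fastforce
  then show ?thesis
    by (simp add: msg_count_def)
qed

text \<open>A unit kept at a level \<open>a\<close> not below the current one was tested at a level
  of at most \<open>a\<close>, since levels only rise, and passed by antitonicity. For
  \<open>a\<close> below the current level, later units face a stricter test, and only the
  inequality remains.\<close>

lemma msg_count_hist:
  assumes "set S \<subseteq> {..<k} \<times> {..<n}" "a < A" "i < n"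
  shows "msg_count (hist e r S) i a \<le> kept_count e r S i a"
    and "level e (hist e r S) \<le> a \<Longrightarrow> msg_count (hist e r S) i a = kept_count e r S i a"
proof -
  have "msg_count (hist e r S) i a \<le> kept_count e r S i a \<and>
     (level e (hist e r S) \<le> a \<longrightarrow> msg_count (hist e r S) i a = kept_count e r S i a)"
    using assms(1)
  proof (induction S rule: rev_induct)
    case Nil
    then show ?case
      by (simp add: msg_count_def kept_count_def)
  next
    case (snoc u S)
    obtain j i' where u: "u = (j, i')" "j < k" "i' < n"
      using snoc.prems by (cases u) auto
    let ?v = "Suc (count_list S u)"
    let ?K = "kept e (r j (prod_encode (i', ?v))) i' ?v"
    have mc: "msg_count (hist e r (S @ [u])) i a = msg_count (hist e r S) i a +
        (if sends e r S u \<and> i' = i \<and> ?K a then 1 else 0)"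
      using assms u by (auto simp: hist_snoc msg_count_enc kept_levels_le less_kept_levels_iff)
    have kc: "kept_count e r (S @ [u]) i a = kept_count e r S i a + (if i' = i \<and> ?K a then 1 else 0)"
      using u by (auto simp: kept_count_snoc)
    have le: "level e (hist e r S) \<le> level e (hist e r (S @ [u]))"
      by (simp add: hist_snoc level_mono)
    have "sends e r S u" if "level e (hist e r (S @ [u])) \<le> a" "?K a"
      using that le u kept_antimono[OF that(2), of "level e (hist e r S)"] by (simp add: sends_def)
    then show ?case
      using snoc le mc kc by auto
  qed
  then show "msg_count (hist e r S) i a \<le> kept_count e r S i a"
    and "level e (hist e r S) \<le> a \<Longrightarrow> msg_count (hist e r S) i a = kept_count e r S i a"
    by auto
qed

text \<open>The largest ineligible local count bounds the number of ineligible units and, being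
  ineligible, has mass below \<open>thr a / (32 * real k)\<close>. Over \<open>k\<close> servers
  this adds up to \<open>thr a / 32\<close>.\<close>

lemma ineligible_mass:
  "(real f - real (card {v\<in>{1..f}. eligible e i a v})) * weight e i \<le> thr a / (32 * real k)"
proof -
  let ?J = "{v\<in>{1..f}. \<not> eligible e i a v}"
  have "{1..f} = {v\<in>{1..f}. eligible e i a v} \<union> ?J"
    by auto
  then have "f = card ({v\<in>{1..f}. eligible e i a v} \<union> ?J)"
    by (metis card_atLeastAtMost diff_Suc_1)
  also have "\<dots> = card {v\<in>{1..f}. eligible e i a v} + card ?J"
    by (intro card_Un_disjoint) auto
  finally have f: "real f - real (card {v\<in>{1..f}. eligible e i a v}) = real (card ?J)"
    by linarith
  show ?thesis
  proof (cases "?J = {}")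
    case True
    then show ?thesis
      unfolding f by (simp only: True) (simp add: less_imp_le)
  next
    case False
    define x where "x = Max ?J"
    have x: "x \<in> ?J"
      unfolding x_def using False by (intro Max_in) auto
    have "?J \<subseteq> {1..x}"
      unfolding x_def by (auto intro!: Max_ge)
    then have "card ?J \<le> x"
      using card_mono[of "{1..x}" ?J] by simp
    then have "real (card ?J) * weight e i \<le> real x * weight e i"
      by (intro mult_right_mono) auto
    also have "\<dots> \<le> thr a / (32 * real k)"
      using x k_ge_1 by (simp add: eligible_def field_simps)
    finally show ?thesis
      unfolding f .
  qed
qed

lemma eligible_count_bounds:
  shows "real (eligible_count e S i a) * weight e i \<le> scaled_freq p k e S i"
    and "scaled_freq p k e S i \<le> real (eligible_count e S i a) * weight e i + thr a / 32"
proof -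
  have "card {v\<in>{1..count_list S (j, i)}. eligible e i a v} \<le> count_list S (j, i)" for j
    by (rule order_trans[OF card_mono[of "{1..count_list S (j, i)}"]]) auto
  then have "eligible_count e S i a \<le> freq k S i"
    unfolding eligible_count_def freq_def local_freq_def by (intro sum_mono)
  then show "real (eligible_count e S i a) * weight e i \<le> scaled_freq p k e S i"
    unfolding scaled_freq_eq by (intro mult_right_mono) auto
  have "scaled_freq p k e S i - real (eligible_count e S i a) * weight e i =
      (\<Sum>j<k. (real (count_list S (j, i)) - real (card {v\<in>{1..count_list S (j, i)}. eligible e i a v})) * weight e i)"
    by (simp add: scaled_freq_eq freq_def local_freq_def eligible_count_def sum_subtractf sum_distrib_right left_diff_distrib)
  also have "\<dots> \<le> (\<Sum>j<k. thr a / (32 * real k))"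
    by (intro sum_mono ineligible_mass)
  also have "\<dots> = thr a / 32"
    using k_ge_1 by simp
  finally show "scaled_freq p k e S i \<le> real (eligible_count e S i a) * weight e i + thr a / 32"
    by simp
qed

text \<open>One of the two summands \<open>thr a\<close> is the sampling error, the other the
  ineligible mass.\<close>

lemma accurate_scaled_freq:
  assumes "accurate e r S i a"
  shows "\<bar>real (kept_count e r S i a) * unit_mass e i a - scaled_freq p k e S i\<bar> \<le> (scaled_freq p k e S i + 2 * thr a) / 32"
  using assms eligible_count_bounds[of e S i a] unfolding accurate_def abs_le_iff by (simp add: field_simps)

section \<open>Threshold and output on an accurate prefix\<close>

context
  fixes e r S
  assumes S: "set S \<subseteq> {..<k} \<times> {..<n}" "S \<noteq> []"
    and acc: "all_accurate e r S" and range: "in_range e S"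
begin

text \<open>At level \<open>0\<close> any coordinate of the stream will do, as its weight is at
  least \<open>base\<close>. Otherwise the failed test one level below gives an estimate of at least
  the current threshold \<open>T\<close>, which is twice the lower one; with the error bound,
  \<open>T \<le> g + (g + T) / 32\<close>, which is the constant 33/31.\<close>

lemma thr_level_le: "\<exists>i<n. thr (level e (hist e r S)) \<le> 33 / 31 * scaled_freq p k e S i"
proof (cases "level e (hist e r S)")
  case 0
  obtain j i where u: "(j, i) \<in> set S" "j < k" "i < n"
    using S by (cases S) auto
  have "1 \<le> local_freq S j i"
    using u by (simp add: local_freq_def Suc_le_eq count_list_0_iff flip: neq0_conv)
  also have "local_freq S j i \<le> freq k S i"
    unfolding freq_def using u by (intro member_le_sum) auto
  finally have "1 * weight e i \<le> scaled_freq p k e S i"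
    unfolding scaled_freq_eq by (intro mult_right_mono) auto
  moreover have "base \<le> weight e i"
    using range u by (simp add: in_range_def)
  ultimately have "thr (level e (hist e r S)) \<le> 33 / 31 * scaled_freq p k e S i"
    using 0 base_pos by (simp add: thr_def)
  then show ?thesis
    using u by auto
next
  case (Suc a)
  have a: "a < A"
    using level_le[of e "hist e r S"] Suc by simp
  obtain i where i: "i < n" "2 * thr a \<le> est e (hist e r S) i a"
    using est_ge_below_level[of a e "hist e r S"] Suc by auto
  have "est e (hist e r S) i a \<le> real (kept_count e r S i a) * unit_mass e i a"
    unfolding est_def using msg_count_hist(1)[OF S(1) a i(1)] unit_mass_pos[of e i a]
    by (intro mult_right_mono) auto
  moreover have "accurate e r S i a"
    using acc a i by (simp add: all_accurate_def)
  ultimately show ?thesis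
    using accurate_scaled_freq[of e r S i a] i thr_Suc[of a] Suc unfolding abs_le_iff
    by (intro exI[of _ i]) (auto simp: field_simps)
qed

text \<open>\<open>in_range\<close> leaves a factor 2 between the scaled frequencies and
  \<open>thr A\<close>, and the preceding bound loses only 33/31.\<close>

lemma level_less: "level e (hist e r S) < A"
proof (rule ccontr)
  assume "\<not> level e (hist e r S) < A"
  then have A: "level e (hist e r S) = A"
    using level_le[of e "hist e r S"] by simp
  obtain i where i: "i < n" "thr A \<le> 33 / 31 * scaled_freq p k e S i"
    using thr_level_le A by auto
  have "scaled_freq p k e S i \<le> real (length S) * weight e i"
    unfolding scaled_freq_eq using freq_le_length[OF S(1)] by (intro mult_right_mono) auto
  also have "\<dots> \<le> thr A / 2"
    using range i by (simp add: in_range_def)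
  finally show False
    using i thr_pos[of A] by simp
qed

lemma est_level_error:
  assumes "i < n"
  shows "\<bar>est e (hist e r S) i (level e (hist e r S)) - scaled_freq p k e S i\<bar> \<le> (scaled_freq p k e S i + 2 * thr (level e (hist e r S))) / 32"
proof -
  have "est e (hist e r S) i (level e (hist e r S)) = real (kept_count e r S i (level e (hist e r S))) * unit_mass e i (level e (hist e r S))"
    unfolding est_def using msg_count_hist(2)[OF S(1) level_less assms] by simp
  then show ?thesis
    using accurate_scaled_freq[of e r S i "level e (hist e r S)"] acc assms level_less by (simp add: all_accurate_def)
qed

text \<open>This direction serves the communication bound: a large maximum forces a high threshold
  and hence few reports.\<close>

lemma scaled_freq_le_thr_level: "i < n \<Longrightarrow> scaled_freq p k e S i \<le> 4 * thr (level e (hist e r S))"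
  using est_level_error[of i] est_less_at_level[of i e "hist e r S"] thr_pos[of "level e (hist e r S)"] unfolding abs_le_iff
  by (simp add: field_simps)

text \<open>With errors of at most \<open>G / 10\<close>, a maximizer has estimate at least
  \<open>0.9 G\<close>, more than half of any estimate, as these are at most \<open>1.1 G\<close>. A
  listed coordinate has estimate at least \<open>0.45 G\<close>, hence scaled frequency at least
  \<open>0.35 G\<close>.\<close>

lemma valid_output: "valid_PL n (scaled_freq p k e S) (coord_out tracking_protocol e s (hist e r S))"
proof -
  define G where "G = Max (scaled_freq p k e S ` {..<n})"
  have fin: "finite (scaled_freq p k e S ` {..<n})" "scaled_freq p k e S ` {..<n} \<noteq> {}"
    using n_ge_2 by (auto simp: lessThan_empty_iff)
  have le_G: "scaled_freq p k e S i \<le> G" if "i < n" for i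
    unfolding G_def using that fin by (intro Max_ge) auto
  obtain m where m: "m < n" "scaled_freq p k e S m = G"
    using Max_in[OF fin] by (auto simp: G_def)
  define x where "x = (\<lambda>i. est e (hist e r S) i (level e (hist e r S)))"
  obtain i0 where "i0 < n" "thr (level e (hist e r S)) \<le> 33 / 31 * scaled_freq p k e S i0"
    using thr_level_le by auto
  then have T: "thr (level e (hist e r S)) \<le> 33 / 31 * G"
    using le_G[of i0] by simp
  then have G_pos: "G > 0"
    using thr_pos[of "level e (hist e r S)"] by linarith
  \<comment> \<open>The relative error is at most \<open>(1 + 2 * 33 / 31) / 32\<close>, slightly
    less than 1/10.\<close>
  have err: "\<bar>x i - scaled_freq p k e S i\<bar> \<le> G / 10" if "i < n" for i
    unfolding x_def using T le_G[OF that] G_pos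
    by (intro order_trans[OF est_level_error[OF that]]) (simp add: field_simps)
  have out: "coord_out tracking_protocol e s (hist e r S) = {i. i < n \<and> (\<forall>i'<n. x i \<ge> x i' / 2)}"
    by (simp add: tracking_protocol_def x_def)
  show ?thesis
    unfolding valid_PL_def out G_def[symmetric]
  proof (intro conjI allI impI ballI)
    fix i assume "is_arg_max (scaled_freq p k e S) (\<lambda>i. i < n) i"
    then have i: "i < n" "scaled_freq p k e S m \<le> scaled_freq p k e S i"
      using m(1) by (auto simp: is_arg_max_def not_less dest!: spec[of _ m])
    have "x i' / 2 \<le> x i" if "i' < n" for i'
      using err[of i] err[of i'] i m that le_G[of i'] G_pos unfolding abs_le_iff by simp
    then show "i \<in> {i. i < n \<and> (\<forall>i'<n. x i \<ge> x i' / 2)}"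
      using i by auto
  next
    fix i assume "i \<in> {i. i < n \<and> (\<forall>i'<n. x i \<ge> x i' / 2)}"
    then have "i < n" "x m / 2 \<le> x i"
      using m by auto
    then show "1 / 4 * G \<le> scaled_freq p k e S i"
      using err[of i] err[of m] m G_pos unfolding abs_le_iff by linarith
  qed auto
qed

end

lemma correct_nowI:
  assumes S: "set S \<subseteq> {..<k} \<times> {..<n}" and good: "all_accurate e r S" "in_range e S"
  shows "correct_now p n k tracking_protocol S (e, r, s)"
proof -
  obtain c where c: "run tracking_protocol k (e, r, s) S = Some c" "coord_hist c = hist e r S"
    using run_Some[OF S, of e r s] by auto
  have "valid_PL n (scaled_freq p k e S) (coord_out tracking_protocol e s (hist e r S))"
  proof (cases "S = []")
    case True
    \<comment> \<open>Before the first update every coordinate is a maximizer, and without reports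
      every estimate is zero, so all coordinates are listed.\<close>
    have "scaled_freq p k e [] = (\<lambda>_. 0)"
      by (simp add: fun_eq_iff scaled_freq_def freq_def local_freq_def)
    moreover have "(\<lambda>_. 0::real) ` {..<n} = {0}"
      using n_ge_2 by (auto intro: image_eqI[of _ _ 0])
    moreover have "coord_out tracking_protocol e s [] = {..<n}"
      by (auto simp: tracking_protocol_def est_def msg_count_def)
    ultimately show ?thesis
      using True by (auto simp: valid_PL_def is_arg_max_def)
  qed (rule valid_output[OF S _ good])
  then show ?thesis
    using c by simp
qed

end

section \<open>Uniform tapes and exponential variables\<close>

abbreviation std_exponential :: "real measure" where
  "std_exponential \<equiv> density lborel (exponential_density 1)"

abbreviation unit_uniform :: "real measure" where
  "unit_uniform \<equiv> uniform_measure lborel {0..1}"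

lemma prob_space_unit_uniform: "prob_space unit_uniform"
  by (rule prob_space_uniform_measure) auto

lemma measurable_unit_uniform [simp]:
  "measurable unit_uniform N = measurable borel N" "measurable N unit_uniform = measurable N borel"
  by (auto intro!: measurable_cong_sets)

lemma prob_space_tape: "prob_space tape_measure"
  unfolding tape_measure_def by (rule prob_space_PiM) (rule prob_space_unit_uniform)

lemma space_tape [simp]: "space tape_measure = UNIV"
  by (simp add: tape_measure_def space_PiM)

lemma measurable_tape [measurable]: "(\<lambda>x. x m) \<in> borel_measurable tape_measure"
proof -
  have "(\<lambda>x. x m) \<in> measurable tape_measure unit_uniform"
    unfolding tape_measure_def by (rule measurable_component_singleton) simp
  then show ?thesis
    by simp
qed

lemma product_prob_spaceI: "(\<And>i. prob_space (M i)) \<Longrightarrow> product_prob_space M"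
  by (simp add: product_prob_space_def product_sigma_finite_def product_prob_space_axioms_def
      prob_space_imp_sigma_finite)

lemma emeasure_unit_uniform_atMost:
  assumes "0 \<le> x"
  shows "emeasure unit_uniform {..x} = ennreal (min 1 x)"
proof -
  have "{0..1} \<inter> {..x} = {0..min 1 x}"
    by auto
  then show ?thesis
    using assms by (simp add: emeasure_uniform_measure divide_ennreal[of _ 1, simplified])
qed

text \<open>The moment generating function of the indicator of \<open>u \<le> x\<close>, a Bernoulli
  variable with mean \<open>min 1 x\<close>.\<close>

lemma nn_integral_unit_uniform_step:
  assumes "0 \<le> x"
  shows "(\<integral>\<^sup>+u. ennreal (if u \<le> x then exp s else 1) \<partial>unit_uniform) =
           ennreal (1 + min 1 x * (exp s - 1))"
proof -
  interpret prob_space unit_uniform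
    by (rule prob_space_unit_uniform)
  have le: "emeasure unit_uniform {..x} = ennreal (min 1 x)"
    by (rule emeasure_unit_uniform_atMost[OF assms])
  then have "prob {..x} = min 1 x"
    using assms by (simp add: measure_def)
  then have "prob {x<..} = 1 - min 1 x"
    using prob_compl[of "{..x}"] by (simp add: Compl_eq_Diff_UNIV[symmetric] )
  then have gt: "emeasure unit_uniform {x<..} = ennreal (1 - min 1 x)"
    by (simp add: emeasure_eq_measure)
  have "(\<integral>\<^sup>+u. ennreal (if u \<le> x then exp s else 1) \<partial>unit_uniform) =
        (\<integral>\<^sup>+u. ennreal (exp s) * indicator {..x} u + indicator {x<..} u \<partial>unit_uniform)"
    by (intro nn_integral_cong) (auto split: split_indicator)
  also have "\<dots> = ennreal (exp s) * ennreal (min 1 x) + ennreal (1 - min 1 x)"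
    by (subst nn_integral_add) (simp_all add: nn_integral_cmult le gt)
  also have "\<dots> = ennreal (1 + min 1 x * (exp s - 1))"
    using assms by (simp add: ennreal_mult[symmetric] ennreal_plus[symmetric] algebra_simps del: ennreal_plus)
  finally show ?thesis .
qed

text \<open>Only the cells in \<open>I\<close> matter, and the restriction of the infinite product
  to a finite index set is the finite product.\<close>

lemma nn_integral_tape_prod:
  assumes "finite I" and [measurable]: "\<And>m. m \<in> I \<Longrightarrow> f m \<in> borel_measurable borel"
  shows "(\<integral>\<^sup>+x. (\<Prod>m\<in>I. f m (x m)) \<partial>tape_measure) = (\<Prod>m\<in>I. \<integral>\<^sup>+u. f m u \<partial>unit_uniform)"
proof -
  interpret product_prob_space "\<lambda>_::nat. unit_uniform" UNIV
    by (rule product_prob_spaceI) (rule prob_space_unit_uniform)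
  have "(\<integral>\<^sup>+x. (\<Prod>m\<in>I. f m (x m)) \<partial>tape_measure) =
        (\<integral>\<^sup>+x. (\<Prod>m\<in>I. f m (restrict x I m)) \<partial>tape_measure)"
    by simp
  also have "\<dots> = (\<integral>\<^sup>+x. (\<Prod>m\<in>I. f m (x m)) \<partial>distr tape_measure (PiM I (\<lambda>_. unit_uniform)) (\<lambda>x. restrict x I))"
    unfolding tape_measure_def
    by (subst nn_integral_distr)
       (auto intro!: measurable_restrict_subset borel_measurable_prod_ennreal measurable_compose[OF measurable_component_singleton])
  also have "distr tape_measure (PiM I (\<lambda>_. unit_uniform)) (\<lambda>x. restrict x I) = PiM I (\<lambda>_. unit_uniform)"
    unfolding tape_measure_def using assms by (intro distr_PiM_restrict_finite) auto
  also have "(\<integral>\<^sup>+x. (\<Prod>m\<in>I. f m (x m)) \<partial>PiM I (\<lambda>_. unit_uniform)) = (\<Prod>m\<in>I. \<integral>\<^sup>+u. f m u \<partial>unit_uniform)"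
    using assms by (intro product_nn_integral_prod) auto
  finally show ?thesis .
qed

lemma nn_integral_tapes_prod:
  fixes f :: "nat \<Rightarrow> nat \<Rightarrow> real \<Rightarrow> ennreal"
  assumes "\<And>j. j < k \<Longrightarrow> finite (I j)"
    and [measurable]: "\<And>j m. f j m \<in> borel_measurable borel"
  shows "(\<integral>\<^sup>+r. (\<Prod>j<k. \<Prod>m\<in>I j. f j m (r j m)) \<partial>(\<Pi>\<^sub>M j\<in>{..<k}. tape_measure)) =
         (\<Prod>j<k. \<Prod>m\<in>I j. \<integral>\<^sup>+u. f j m u \<partial>unit_uniform)"
proof -
  interpret product_prob_space "\<lambda>_::nat. tape_measure" UNIV
    by (rule product_prob_spaceI) (rule prob_space_tape)
  have "(\<integral>\<^sup>+r. (\<Prod>j<k. \<Prod>m\<in>I j. f j m (r j m)) \<partial>(\<Pi>\<^sub>M j\<in>{..<k}. tape_measure)) =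
      (\<Prod>j<k. \<integral>\<^sup>+x. (\<Prod>m\<in>I j. f j m (x m)) \<partial>tape_measure)"
    by (rule product_nn_integral_prod[where f = "\<lambda>j x. \<Prod>m\<in>I j. f j m (x m)"]) auto
  then show ?thesis
    using assms by (simp add: nn_integral_tape_prod)
qed

lemma emeasure_tapes_atMost:
  fixes k :: nat
  assumes "j < k" "0 \<le> x"
  shows "emeasure (\<Pi>\<^sub>M j\<in>{..<k}. tape_measure) {r \<in> space (\<Pi>\<^sub>M j\<in>{..<k}. tape_measure). r j m \<le> x} \<le> ennreal x"
proof -
  interpret T: product_prob_space "\<lambda>_::nat. tape_measure" "{..<k}"
    by (rule product_prob_spaceI) (rule prob_space_tape)
  interpret U: product_prob_space "\<lambda>_::nat. unit_uniform" UNIV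
    by (rule product_prob_spaceI) (rule prob_space_unit_uniform)
  have "{y. y m \<le> x} \<in> sets tape_measure"
    using measurable_sets[OF measurable_tape, of "{..x}" m] by (simp add: vimage_def)
  from T.emeasure_PiM_Collect_single[of j, OF _ this] assms
  have "emeasure (\<Pi>\<^sub>M j\<in>{..<k}. tape_measure) {r \<in> space (\<Pi>\<^sub>M j\<in>{..<k}. tape_measure). r j m \<le> x} =
        emeasure tape_measure {y. y m \<le> x}"
    by simp
  also have "\<dots> = emeasure unit_uniform {..x}"
    using U.emeasure_PiM_Collect_single[of m "{..x}"]
    by (simp add: tape_measure_def space_PiM)
  also have "\<dots> \<le> ennreal x"
    unfolding emeasure_unit_uniform_atMost[OF assms(2)] by (intro ennreal_leI) simp
  finally show ?thesis .
qed

section \<open>Exponential variables: tails, truncated moments, law of the maximum\<close>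

lemma prob_space_std_exponential: "prob_space std_exponential"
  by (rule prob_space_exponential_density) simp

lemma distributed_std_exponential: "distributed std_exponential lborel (\<lambda>x. x) (exponential_density 1)"
  by (auto simp: distributed_def distr_id2 intro!: measure_eqI)

lemma emeasure_std_exponential_greaterThan:
  assumes "0 \<le> a"
  shows "emeasure std_exponential {a<..} = ennreal (exp (- a))"
proof -
  interpret prob_space std_exponential
    by (rule prob_space_std_exponential)
  show ?thesis
    using exponential_distributedD_gt[OF distributed_std_exponential assms]
    by (simp add: emeasure_eq_measure greaterThan_def)
qed

lemma emeasure_std_exponential_atMost:
  assumes "0 \<le> a"
  shows "emeasure std_exponential {..a} = ennreal (1 - exp (- a))"
proof -
  interpret prob_space std_exponential
    by (rule prob_space_std_exponential)
  show ?thesis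
    using exponential_distributedD_le[OF distributed_std_exponential assms]
    by (simp add: emeasure_eq_measure atMost_def)
qed

lemma emeasure_std_exponential_outside:
  assumes "0 \<le> a"
  shows "emeasure std_exponential (- {a..b}) \<le> ennreal (a + exp (- max 0 b))"
proof -
  have "emeasure std_exponential (- {a..b}) \<le> emeasure std_exponential ({..a} \<union> {max 0 b<..})"
    using assms by (intro emeasure_mono) auto
  also have "\<dots> \<le> emeasure std_exponential {..a} + emeasure std_exponential {max 0 b<..}"
    by (intro emeasure_subadditive) auto
  also have "\<dots> = ennreal (1 - exp (- a) + exp (- max 0 b))"
    using assms by (simp add: emeasure_std_exponential_atMost emeasure_std_exponential_greaterThan)
  also have "\<dots> \<le> ennreal (a + exp (- max 0 b))"
    using exp_ge_add_one_self[of "- a"] by (intro ennreal_leI) simp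
  finally show ?thesis .
qed

lemma nn_integral_exponentials_component:
  assumes "i < n" and [measurable]: "f \<in> borel_measurable borel"
  shows "(\<integral>\<^sup>+e. f (e i) \<partial>(\<Pi>\<^sub>M i\<in>{..<n}. std_exponential)) = (\<integral>\<^sup>+x. f x \<partial>std_exponential)"
proof -
  have "(\<integral>\<^sup>+x. f x \<partial>std_exponential) =
        (\<integral>\<^sup>+x. f x \<partial>distr (\<Pi>\<^sub>M i\<in>{..<n}. std_exponential) std_exponential (\<lambda>e. e i))"
    using assms by (subst distr_PiM_component) (auto intro: prob_space_std_exponential)
  also have "\<dots> = (\<integral>\<^sup>+e. f (e i) \<partial>(\<Pi>\<^sub>M i\<in>{..<n}. std_exponential))"
    using assms measurable_component_singleton[of i "{..<n}" "\<lambda>_. std_exponential"]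
    by (subst nn_integral_distr) auto
  finally show ?thesis ..
qed

text \<open>
  Since \<open>x powr (- 1 / p) = (x powr (1 / p)) powr (p - 1) / x\<close>, the constraint bounds the integrand
  by \<open>B powr (p - 1) / x\<close>, which also covers \<open>p = 1\<close>.
\<close>

lemma nn_integral_exponential_powr_le:
  assumes "p \<ge> 1" "0 < lo" "lo \<le> hi" "0 < B"
  shows "(\<integral>\<^sup>+x. ennreal (1 / x powr (1 / p)) * indicator {x. lo \<le> x \<and> x \<le> hi \<and> x powr (1 / p) \<le> B} x
            \<partial>std_exponential) \<le> ennreal (B powr (p - 1) * ln (hi / lo))"
proof -
  let ?I = "{x. lo \<le> x \<and> x \<le> hi \<and> x powr (1 / p) \<le> B}"
  have "(\<integral>\<^sup>+x. ennreal (1 / x powr (1 / p)) * indicator ?I x \<partial>std_exponential) =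
      (\<integral>\<^sup>+x. ennreal (exponential_density 1 x) * (ennreal (1 / x powr (1 / p)) * indicator ?I x) \<partial>lborel)"
    by (subst nn_integral_density) auto
  also have "\<dots> \<le> (\<integral>\<^sup>+x. ennreal (B powr (p - 1) / x) * indicator {lo..hi} x \<partial>lborel)"
  proof (intro nn_integral_mono)
    fix x :: real
    show "ennreal (exponential_density 1 x) * (ennreal (1 / x powr (1 / p)) * indicator ?I x)
        \<le> ennreal (B powr (p - 1) / x) * indicator {lo..hi} x"
    proof (cases "x \<in> ?I")
      case True
      then have x: "x > 0" "x powr (1 / p) \<le> B"
        using assms by auto
      have "1 / x powr (1 / p) = (x powr (1 / p)) powr (p - 1) / x"
        using x assms by (simp add: powr_powr powr_diff field_simps flip: powr_add)
      also have "\<dots> \<le> B powr (p - 1) / x"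
        using x assms by (intro divide_right_mono powr_mono2) auto
      \<comment> \<open>The density is bounded by 1; the cutoffs \<open>lo\<close> and
        \<open>hi\<close> then make the integral of \<open>1 / x\<close> a logarithm.\<close>
      finally have "exponential_density 1 x * (1 / x powr (1 / p)) \<le> 1 * (B powr (p - 1) / x)"
        using x by (intro mult_mono) (auto simp: exponential_density_def)
      then show ?thesis
        using True by (simp add: ennreal_mult[symmetric] ennreal_leI exponential_density_nonneg)
    qed simp
  qed
  also have "\<dots> = ennreal (B powr (p - 1) * ln hi - B powr (p - 1) * ln lo)"
    using assms
    by (intro nn_integral_FTC_Icc) (auto intro!: derivative_eq_intros simp: has_real_derivative_iff_has_vector_derivative[symmetric])
  also have "\<dots> = ennreal (B powr (p - 1) * ln (hi / lo))"
    using assms by (simp add: ln_div algebra_simps)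
  finally show ?thesis .
qed

text \<open>This is the law of the maximum: by independence the probabilities \<open>exp (- ((f i / x) powr p))\<close> multiply.\<close>

lemma emeasure_scaled_all_less:
  fixes f :: "nat \<Rightarrow> real"
  assumes "p \<ge> 1" "0 < x" "\<And>i. i < n \<Longrightarrow> 0 \<le> f i"
  shows "emeasure (\<Pi>\<^sub>M i\<in>{..<n}. std_exponential)
           {e \<in> space (\<Pi>\<^sub>M i\<in>{..<n}. std_exponential). \<forall>i<n. f i * (1 / e i powr (1 / p)) < x}
         \<le> ennreal (exp (- (\<Sum>i<n. f i powr p) / x powr p))"
proof -
  interpret product_prob_space "\<lambda>_::nat. std_exponential" "{..<n}"
    by (rule product_prob_spaceI) (rule prob_space_std_exponential)
  \<comment> \<open>The half-line \<open>{..0}\<close> is a null set; it absorbs the sample points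
    outside the range where \<open>powr\<close> is the usual power.\<close>
  let ?B = "\<lambda>i. {..0} \<union> {(f i / x) powr p<..} :: real set"
  have "f i * (1 / y powr (1 / p)) < x \<Longrightarrow> y \<in> ?B i" if "i < n" for i y
  proof (cases "y \<le> 0")
    case False
    assume "f i * (1 / y powr (1 / p)) < x"
    then have "f i / x < y powr (1 / p)"
      using False assms by (simp add: field_simps)
    then have "(f i / x) powr p < (y powr (1 / p)) powr p"
      using assms that by (intro powr_less_mono2) auto
    then show ?thesis
      using False assms by (simp add: powr_powr)
  qed simp
  then have "{e \<in> space (\<Pi>\<^sub>M i\<in>{..<n}. std_exponential). \<forall>i<n. f i * (1 / e i powr (1 / p)) < x} \<subseteq> PiE {..<n} ?B"
    by (auto simp: space_PiM PiE_def Pi_iff)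
  then have "emeasure (\<Pi>\<^sub>M i\<in>{..<n}. std_exponential)
           {e \<in> space (\<Pi>\<^sub>M i\<in>{..<n}. std_exponential). \<forall>i<n. f i * (1 / e i powr (1 / p)) < x} \<le>
        emeasure (\<Pi>\<^sub>M i\<in>{..<n}. std_exponential) (PiE {..<n} ?B)"
    by (intro emeasure_mono sets_PiM_I_finite) auto
  also have "\<dots> = (\<Prod>i<n. emeasure std_exponential (?B i))"
    by (intro emeasure_PiM) auto
  also have "\<dots> \<le> (\<Prod>i<n. ennreal (exp (- ((f i / x) powr p))))"
  proof (intro prod_mono_ennreal)
    fix i assume "i \<in> {..<n}"
    have "emeasure std_exponential (?B i) \<le> emeasure std_exponential {..0} + emeasure std_exponential {(f i / x) powr p<..}"
      by (intro emeasure_subadditive) auto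
    then show "emeasure std_exponential (?B i) \<le> ennreal (exp (- ((f i / x) powr p)))"
      by (simp add: emeasure_std_exponential_atMost emeasure_std_exponential_greaterThan)
  qed
  also have "\<dots> = ennreal (exp (- (\<Sum>i<n. f i powr p) / x powr p))"
    using assms by (simp add: prod_ennreal exp_sum[symmetric] sum_negf sum_divide_distrib powr_divide)
  finally show ?thesis .
qed

section \<open>Measurability\<close>

context tracker
begin

abbreviation tapes :: "(nat \<Rightarrow> nat \<Rightarrow> real) measure" where
  "tapes \<equiv> \<Pi>\<^sub>M j\<in>{..<k}. tape_measure"

abbreviation exponentials :: "(nat \<Rightarrow> real) measure" where
  "exponentials \<equiv> \<Pi>\<^sub>M i\<in>{..<n}. std_exponential"

lemma prob_space_tapes: "prob_space tapes"
  by (rule prob_space_PiM) (rule prob_space_tape)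

lemma prob_space_exponentials: "prob_space exponentials"
  by (rule prob_space_PiM) (rule prob_space_std_exponential)

lemma prob_space_randomness: "prob_space (randomness n k)"
  unfolding randomness_def
  by (intro prob_space_pair prob_space_exponentials prob_space_tapes prob_space_tape)

context
  fixes M :: "'z measure" and e :: "'z \<Rightarrow> nat \<Rightarrow> real" and r :: "'z \<Rightarrow> nat \<Rightarrow> nat \<Rightarrow> real"
  assumes e: "\<And>i. i < n \<Longrightarrow> (\<lambda>\<omega>. e \<omega> i) \<in> borel_measurable M"
    and r: "\<And>j m. j < k \<Longrightarrow> (\<lambda>\<omega>. r \<omega> j m) \<in> borel_measurable M"
begin

text \<open>\<open>M\<close> is left abstract so that these facts apply both to the whole sample
  space and to the tapes alone with the exponentials frozen.\<close>

lemma measurable_weight: "i < n \<Longrightarrow> (\<lambda>\<omega>. weight (e \<omega>) i) \<in> borel_measurable M"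
  using e[of i] unfolding weight_def by measurable

lemma pred_kept:
  assumes "i < n" "j < k"
  shows "Measurable.pred M (\<lambda>\<omega>. kept (e \<omega>) (r \<omega> j m) i v a)"
  using measurable_weight[OF assms(1)] r[OF assms(2), of m] unfolding kept_def by measurable

lemma measurable_kept_levels:
  assumes "i < n" "j < k"
  shows "(\<lambda>\<omega>. kept_levels (e \<omega>) (r \<omega> j m) i v) \<in> measurable M (count_space UNIV)"
proof -
  have "kept_levels (e \<omega>) (r \<omega> j m) i v = (\<Sum>a<A. if kept (e \<omega>) (r \<omega> j m) i v a then 1 else 0)" for \<omega>
    by (simp add: kept_levels_def sum.If_cases Int_def)
  then show ?thesis
    using pred_kept[OF assms] by (simp only:) measurable
qed

lemma measurable_est:
  assumes "i < n"
  shows "(\<lambda>\<omega>. est (e \<omega>) h i a) \<in> borel_measurable M"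
  using measurable_weight[OF assms] unfolding est_def unit_mass_def by measurable

lemma measurable_level: "(\<lambda>\<omega>. level (e \<omega>) h) \<in> measurable M (count_space UNIV)"
proof -
  have "level (e \<omega>) h = (LEAST a. \<forall>i\<in>{..<n}. est (e \<omega>) h i a < 2 * thr a)" for \<omega>
    by (simp add: level_def Ball_def)
  moreover have "Measurable.pred M (\<lambda>\<omega>. \<forall>i\<in>{..<n}. est (e \<omega>) h i a < 2 * thr a)" for a
  proof -
    have [measurable]: "(\<lambda>\<omega>. est (e \<omega>) h i a) \<in> borel_measurable M" if "i \<in> {..<n}" for i
      using measurable_est that by simp
    show ?thesis
      by measurable
  qed
  then have "(\<lambda>\<omega>. LEAST a. \<forall>i\<in>{..<n}. est (e \<omega>) h i a < 2 * thr a) \<in> measurable M (count_space UNIV)"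
    by (rule measurable_Least)
  ultimately show ?thesis
    by simp
qed

lemma pred_kept_level:
  assumes "i < n" "j < k"
  shows "Measurable.pred M (\<lambda>\<omega>. kept (e \<omega>) (r \<omega> j m) i v (level (e \<omega>) h))"
  using measurable_compose_countable[OF pred_kept[OF assms] measurable_level] by simp

text \<open>Histories form a countable type, so each step may be checked for a constant history
  \<open>h\<close>; the random level is treated in the same way.\<close>

lemma measurable_hist:
  assumes "set S \<subseteq> {..<k} \<times> {..<n}"
  shows "(\<lambda>\<omega>. hist (e \<omega>) (r \<omega>) S) \<in> measurable M (count_space UNIV)"
  using assms
proof (induction S rule: rev_induct)
  case (snoc u S)
  obtain j i where u: "u = (j, i)" "j < k" "i < n"
    using snoc.prems by (cases u) auto
  define m where "m = prod_encode (i, Suc (count_list S u))"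
  define step where "step = (\<lambda>h \<omega>. h @ (if kept (e \<omega>) (r \<omega> j m) i (Suc (count_list S u)) (level (e \<omega>) h)
      then [(j, enc (i, kept_levels (e \<omega>) (r \<omega> j m) i (Suc (count_list S u))))] else []))"
  have "step h \<in> measurable M (count_space UNIV)" for h
  proof -
    have "(\<lambda>\<omega>. (\<lambda>b. h @ [(j, enc (i, b))]) (kept_levels (e \<omega>) (r \<omega> j m) i (Suc (count_list S u))))
        \<in> measurable M (count_space UNIV)"
      by (rule measurable_compose[OF measurable_kept_levels[OF u(3,2)]]) simp
    then have "(\<lambda>\<omega>. if kept (e \<omega>) (r \<omega> j m) i (Suc (count_list S u)) (level (e \<omega>) h)
        then h @ [(j, enc (i, kept_levels (e \<omega>) (r \<omega> j m) i (Suc (count_list S u))))] else h)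
        \<in> measurable M (count_space UNIV)"
      using pred_kept_level[OF u(3,2)] by (intro measurable_If_restrict_space_iff[THEN iffD2] measurable_If) auto
    then show ?thesis
      unfolding step_def by (rule measurable_cong[THEN iffD1, rotated]) auto
  qed
  from measurable_compose_countable[OF this snoc.IH] snoc.prems
  have "(\<lambda>\<omega>. step (hist (e \<omega>) (r \<omega>) S) \<omega>) \<in> measurable M (count_space UNIV)"
    by auto
  moreover have "hist (e \<omega>) (r \<omega>) (S @ [u]) = step (hist (e \<omega>) (r \<omega>) S) \<omega>" for \<omega>
    by (auto simp: hist_snoc sends_def step_def m_def u)
  ultimately show ?case
    by simp
qed simp

lemma measurable_bits:
  assumes "set S \<subseteq> {..<k} \<times> {..<n}"
  shows "(\<lambda>\<omega>. bits (e \<omega>) (hist (e \<omega>) (r \<omega>) S)) \<in> measurable M (count_space UNIV)"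
proof (rule measurable_compose_countable[OF _ measurable_hist[OF assms]])
  fix h
  show "(\<lambda>\<omega>. bits (e \<omega>) h) \<in> measurable M (count_space UNIV)"
    using measurable_level unfolding bits_def by measurable
qed

lemma pred_valid_output:
  assumes "set S \<subseteq> {..<k} \<times> {..<n}"
  shows "Measurable.pred M (\<lambda>\<omega>. valid_PL n (scaled_freq p k (e \<omega>) S)
     (coord_out tracking_protocol (e \<omega>) (s \<omega>) (hist (e \<omega>) (r \<omega>) S)))"
proof (rule measurable_compose_countable[OF _ measurable_hist[OF assms]])
  fix h
  define out where "out = (\<lambda>\<omega> a i. \<forall>i'\<in>{..<n}. est (e \<omega>) h i a \<ge> est (e \<omega>) h i' a / 2)"
  define g where "g = (\<lambda>\<omega>. scaled_freq p k (e \<omega>) S)"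
  have "n > 0"
    using n_ge_2 by simp
  \<comment> \<open>\<open>Max\<close> and \<open>is_arg_max\<close> become finitely many
    comparisons between coordinates.\<close>
  then have valid_iff: "valid_PL n (g \<omega>) (coord_out tracking_protocol (e \<omega>) (s \<omega>) h) \<longleftrightarrow>
     (\<forall>i\<in>{..<n}. (\<forall>i'\<in>{..<n}. g \<omega> i' \<le> g \<omega> i) \<longrightarrow> out \<omega> (level (e \<omega>) h) i) \<and>
     (\<forall>i\<in>{..<n}. out \<omega> (level (e \<omega>) h) i \<longrightarrow> (\<forall>i'\<in>{..<n}. 1 / 4 * g \<omega> i' \<le> g \<omega> i))" for \<omega>
  proof -
    have "1 / 4 * Max (g \<omega> ` {..<n}) \<le> x \<longleftrightarrow> (\<forall>i'\<in>{..<n}. 1 / 4 * g \<omega> i' \<le> x)" for x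
      using Max_le_iff[of "g \<omega> ` {..<n}" "4 * x"] \<open>n > 0\<close> by (auto simp: field_simps lessThan_empty_iff)
    moreover have "is_arg_max (g \<omega>) (\<lambda>i. i < n) i \<longleftrightarrow> i < n \<and> (\<forall>i'\<in>{..<n}. g \<omega> i' \<le> g \<omega> i)" for i
      unfolding is_arg_max_def Ball_def lessThan_iff by (meson not_less)
    moreover have "coord_out tracking_protocol (e \<omega>) (s \<omega>) h = {i\<in>{..<n}. out \<omega> (level (e \<omega>) h) i}"
      by (auto simp: tracking_protocol_def out_def)
    ultimately show ?thesis
      unfolding valid_PL_def by auto
  qed
  have [measurable]: "(\<lambda>\<omega>. weight (e \<omega>) i) \<in> borel_measurable M" if "i \<in> {..<n}" for i
    using measurable_weight that by simp
  have [measurable]: "(\<lambda>\<omega>. est (e \<omega>) h i a) \<in> borel_measurable M" if "i \<in> {..<n}" for i a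
    using measurable_est that by simp
  have [measurable]: "(\<lambda>\<omega>. g \<omega> i) \<in> borel_measurable M" if [measurable]: "i \<in> {..<n}" for i
    unfolding g_def scaled_freq_eq by measurable
  have [measurable]: "Measurable.pred M (\<lambda>\<omega>. out \<omega> (level (e \<omega>) h) i)" if [measurable]: "i \<in> {..<n}" for i
  proof (rule measurable_compose_countable[OF _ measurable_level])
    fix a
    show "Measurable.pred M (\<lambda>\<omega>. out \<omega> a i)"
      unfolding out_def by measurable
  qed
  have "Measurable.pred M (\<lambda>\<omega>. valid_PL n (g \<omega>) (coord_out tracking_protocol (e \<omega>) (s \<omega>) h))"
    unfolding valid_iff by measurable
  then show "Measurable.pred M (\<lambda>\<omega>. valid_PL n (scaled_freq p k (e \<omega>) S)
     (coord_out tracking_protocol (e \<omega>) (s \<omega>) h))"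
    unfolding g_def .
qed

lemma measurable_kept_count:
  assumes "i < n"
  shows "(\<lambda>\<omega>. kept_count (e \<omega>) (r \<omega>) S i a) \<in> measurable M (count_space UNIV)"
proof -
  have "kept_count (e \<omega>) (r \<omega>) S i a = (\<Sum>j<k. \<Sum>v\<in>{1..count_list S (j, i)}.
      if kept (e \<omega>) (r \<omega> j (prod_encode (i, v))) i v a then 1 else 0)" for \<omega>
    by (simp add: kept_count_def sum.If_cases Int_def)
  moreover have [measurable]: "Measurable.pred M (\<lambda>\<omega>. kept (e \<omega>) (r \<omega> j m) i v a)" if "j \<in> {..<k}" for j m v
    using pred_kept[OF assms] that by simp
  ultimately show ?thesis
    by (simp only:) measurable
qed

lemma measurable_eligible_count:
  assumes "i < n"
  shows "(\<lambda>\<omega>. eligible_count (e \<omega>) S i a) \<in> measurable M (count_space UNIV)"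
proof -
  have "eligible_count (e \<omega>) S i a = (\<Sum>j<k. \<Sum>v\<in>{1..count_list S (j, i)}.
      if eligible (e \<omega>) i a v then 1 else 0)" for \<omega>
    by (simp add: eligible_count_def sum.If_cases Int_def)
  moreover have "Measurable.pred M (\<lambda>\<omega>. eligible (e \<omega>) i a v)" for v
    using measurable_weight[OF assms] unfolding eligible_def by measurable
  ultimately show ?thesis
    by (simp only:) measurable
qed

lemma pred_accurate:
  assumes "i < n"
  shows "Measurable.pred M (\<lambda>\<omega>. accurate (e \<omega>) (r \<omega>) S i a)"
  using measurable_weight[OF assms] measurable_kept_count[OF assms] measurable_eligible_count[OF assms]
  unfolding accurate_def unit_mass_def by measurable

end

end

section \<open>Concentration of the estimates\<close>

lemma exp_le_quadratic:
  fixes s :: real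
  assumes "\<bar>s\<bar> \<le> 1"
  shows "exp s \<le> 1 + s + s\<^sup>2"
proof (cases "0 \<le> s")
  case True
  then show ?thesis
    using exp_bound[of s] assms by simp
next
  case False
  define t where "t = - s"
  have t: "0 < t" "t \<le> 1"
    using False assms by (auto simp: t_def)
  \<comment> \<open>The product equals \<open>1 + t ^ 3\<close>.\<close>
  have "1 \<le> (1 - t + t\<^sup>2) * (1 + t)"
    using t by (simp add: algebra_simps power2_eq_square)
  also have "\<dots> \<le> (1 - t + t\<^sup>2) * exp t"
    using t exp_ge_add_one_self[of t] by (intro mult_left_mono) (auto simp: add_nonneg_nonneg)
  finally show ?thesis
    by (simp add: t_def exp_minus field_simps)
qed

context tracker
begin

definition keep_prob :: "(nat \<Rightarrow> real) \<Rightarrow> nat \<Rightarrow> nat \<Rightarrow> real" where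
  "keep_prob e i a = min 1 (weight e i * Lam / thr a)"

lemma keep_prob_bounds: "0 \<le> keep_prob e i a" "keep_prob e i a \<le> 1"
  using Lam_pos by (auto simp: keep_prob_def less_imp_le)

text \<open>Inverse probability weighting: the rescaled kept count has expectation
  \<open>eligible_count * weight\<close>.\<close>

lemma keep_prob_unit_mass: "keep_prob e i a * unit_mass e i a = weight e i"
proof (cases "weight e i * Lam \<le> thr a")
  case True
  then show ?thesis
    using Lam_pos thr_pos[of a, THEN less_imp_neq]
    by (simp add: keep_prob_def unit_mass_def field_simps max_def min_def)
next
  case False
  then show ?thesis
    using Lam_pos by (simp add: keep_prob_def unit_mass_def field_simps max_def min_def)
qed

text \<open>For fixed \<open>e\<close> the kept count is binomial: each eligible unit is kept when
  its own tape cell is at most \<open>x\<close>, and distinct units read distinct cells because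
  \<open>prod_encode\<close> is injective.\<close>

lemma kept_count_mgf:
  "(\<integral>\<^sup>+r. ennreal (exp (s * real (kept_count e r S i a))) \<partial>tapes) =
     ennreal ((1 + keep_prob e i a * (exp s - 1)) ^ eligible_count e S i a)"
proof -
  define x where "x = weight e i * Lam / thr a"
  have x: "0 \<le> x"
    using Lam_pos by (simp add: x_def less_imp_le)
  define V where "V = (\<lambda>j. {v\<in>{1..count_list S (j, i)}. eligible e i a v})"
  define I where "I = (\<lambda>j. (\<lambda>v. prod_encode (i, v)) ` V j)"
  have [simp]: "finite (V j)" "finite (I j)" for j
    by (auto simp: V_def I_def)
  have inj: "inj_on (\<lambda>v. prod_encode (i, v)) (V j)" for j
    by (auto simp: inj_on_def prod_encode_eq)
  have "exp (s * real (kept_count e r S i a)) = (\<Prod>j<k. \<Prod>m\<in>I j. if r j m \<le> x then exp s else 1)" for r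
  proof -
    have "exp (s * real (card {v\<in>{1..count_list S (j, i)}. kept e (r j (prod_encode (i, v))) i v a})) =
        (\<Prod>m\<in>I j. if r j m \<le> x then exp s else 1)" for j
    proof -
      have "{v\<in>{1..count_list S (j, i)}. kept e (r j (prod_encode (i, v))) i v a} =
          V j \<inter> {v. r j (prod_encode (i, v)) \<le> x}"
        by (auto simp: V_def kept_def eligible_def x_def)
      then have "exp (s * real (card {v\<in>{1..count_list S (j, i)}. kept e (r j (prod_encode (i, v))) i v a})) =
         (\<Prod>v\<in>V j. if r j (prod_encode (i, v)) \<le> x then exp s else 1)"
        by (simp add: prod.If_cases exp_of_nat2_mult)
      also have "\<dots> = (\<Prod>m\<in>I j. if r j m \<le> x then exp s else 1)"
        by (simp add: I_def prod.reindex[OF inj])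
      finally show ?thesis .
    qed
    then show ?thesis
      by (simp add: kept_count_def sum_distrib_left exp_sum)
  qed
  then have "(\<integral>\<^sup>+r. ennreal (exp (s * real (kept_count e r S i a))) \<partial>tapes) =
      (\<integral>\<^sup>+r. (\<Prod>j<k. \<Prod>m\<in>I j. ennreal (if r j m \<le> x then exp s else 1)) \<partial>tapes)"
    by (simp add: prod_ennreal[symmetric] prod_nonneg)
  also have "\<dots> = (\<Prod>j<k. \<Prod>m\<in>I j. \<integral>\<^sup>+u. ennreal (if u \<le> x then exp s else 1) \<partial>unit_uniform)"
    by (rule nn_integral_tapes_prod[where f = "\<lambda>j m u. ennreal (if u \<le> x then exp s else 1)"]) simp_all
  also have "\<dots> = (\<Prod>j<k. \<Prod>m\<in>I j. ennreal (1 + keep_prob e i a * (exp s - 1)))"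
    using x by (simp add: nn_integral_unit_uniform_step keep_prob_def x_def)
  also have "\<dots> = ennreal (1 + keep_prob e i a * (exp s - 1)) ^ eligible_count e S i a"
    unfolding I_def by (simp only: prod_constant card_image[OF inj]) (simp add: V_def eligible_count_def power_sum)
  also have "\<dots> = ennreal ((1 + keep_prob e i a * (exp s - 1)) ^ eligible_count e S i a)"
  proof (rule ennreal_power)
    have "0 \<le> (1 - keep_prob e i a) + keep_prob e i a * exp s"
      using keep_prob_bounds[of e i a] by (intro add_nonneg_nonneg mult_nonneg_nonneg) auto
    then show "0 \<le> 1 + keep_prob e i a * (exp s - 1)"
      by (simp add: algebra_simps)
  qed
  finally show ?thesis .
qed

lemma measurable_tapes_component: "j < k \<Longrightarrow> (\<lambda>r. r j m) \<in> borel_measurable tapes"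
proof -
  assume "j < k"
  then have "(\<lambda>r. r j) \<in> measurable tapes tape_measure"
    by (intro measurable_component_singleton) simp
  then show ?thesis
    by (rule measurable_compose[OF _ measurable_tape])
qed

lemma measurable_tapes_kept_count:
  "i < n \<Longrightarrow> (\<lambda>r. kept_count e r S i a) \<in> measurable tapes (count_space UNIV)"
  by (rule measurable_kept_count) (auto intro: measurable_tapes_component)

text \<open>Markov's inequality for the exponential; a negative \<open>s\<close> gives the lower
  tail.\<close>

lemma kept_count_tail:
  assumes "i < n"
  shows "emeasure tapes {r \<in> space tapes. y \<le> s * real (kept_count e r S i a)} \<le>
     ennreal (exp (- y) * (1 + keep_prob e i a * (exp s - 1)) ^ eligible_count e S i a)"
proof -
  note [measurable] = measurable_tapes_kept_count[OF assms]
  have "{r \<in> space tapes. y \<le> s * real (kept_count e r S i a)} =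
     {r \<in> space tapes. 1 \<le> ennreal (exp (- y)) * ennreal (exp (s * real (kept_count e r S i a)))}"
    by (simp add: ennreal_mult[symmetric] exp_add[symmetric])
  also have "emeasure tapes \<dots> \<le> ennreal (exp (- y)) *
      (\<integral>\<^sup>+r. ennreal (exp (s * real (kept_count e r S i a))) * indicator (space tapes) r \<partial>tapes)"
    by (rule nn_integral_Markov_inequality) measurable
  also have "(\<integral>\<^sup>+r. ennreal (exp (s * real (kept_count e r S i a))) * indicator (space tapes) r \<partial>tapes) =
      ennreal ((1 + keep_prob e i a * (exp s - 1)) ^ eligible_count e S i a)"
    by (subst kept_count_mgf[symmetric]) (auto intro: nn_integral_cong)
  finally show ?thesis
    by (simp add: ennreal_mult')
qed

text \<open>A Chernoff bound for both tails, selected by the sign \<open>c\<close>.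
  \<open>\<Delta>\<close> is the error allowed by \<open>accurate\<close>, divided by
  \<open>unit_mass\<close>.\<close>

lemma kept_count_one_sided:
  assumes "i < n" and c: "c = 1 \<or> c = (- 1 :: real)" and w: "weight e i > 0"
    and \<Delta>: "\<Delta> = (real (eligible_count e S i a) * weight e i + thr a) / (32 * unit_mass e i a)"
  shows "emeasure tapes {r \<in> space tapes.
           \<Delta> \<le> c * (real (kept_count e r S i a) - real (eligible_count e S i a) * keep_prob e i a)}
         \<le> ennreal (exp (- Lam / 1024))"
proof -
  define q where "q = keep_prob e i a"
  define M where "M = eligible_count e S i a"
  have q: "0 \<le> q" "q \<le> 1"
    using keep_prob_bounds by (auto simp: q_def)
  have \<Delta>_pos: "\<Delta> > 0"
    unfolding \<Delta> using w unit_mass_pos[of e i a] by (intro divide_pos_pos add_nonneg_pos) auto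
  have shift: "{r \<in> space tapes. \<Delta> \<le> c * (real (kept_count e r S i a) - real M * q)} =
     {r \<in> space tapes. c * t * (real M * q) + t * \<Delta> \<le> c * t * real (kept_count e r S i a)}" if "t > 0" for t
  proof -
    have "\<Delta> \<le> c * (x - y) \<longleftrightarrow> c * t * y + t * \<Delta> \<le> c * t * x" for x y
    proof -
      have "\<Delta> \<le> c * (x - y) \<longleftrightarrow> t * \<Delta> \<le> t * (c * (x - y))"
        using that by (simp add: mult_le_cancel_left_pos)
      then show ?thesis
        by (simp add: algebra_simps)
    qed
    then show ?thesis
      by simp
  qed
  have bound: "emeasure tapes {r \<in> space tapes. \<Delta> \<le> c * (real (kept_count e r S i a) - real M * q)} \<le>
     ennreal (exp (- (c * t * (real M * q) + t * \<Delta>)) * (1 + q * (exp (c * t) - 1)) ^ M)" if "t > 0" for t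
    by (subst shift[OF that], unfold q_def M_def) (rule kept_count_tail[OF assms(1)])
  \<comment> \<open>For \<open>q = 1\<close> the count is almost surely exact, and any large \<open>t\<close> works; otherwise \<open>t = 1 / 32\<close>.\<close>
  have "\<exists>t>0. exp (- (c * t * (real M * q) + t * \<Delta>)) * (1 + q * (exp (c * t) - 1)) ^ M \<le> exp (- Lam / 1024)"
  proof (cases "q = 1")
    case True
    define t where "t = Lam / (1024 * \<Delta>)"
    have t: "t > 0" "t * \<Delta> = Lam / 1024"
      using Lam_pos \<Delta>_pos by (auto simp: t_def)
    have "exp (- (c * t * (real M * q) + t * \<Delta>)) * (1 + q * (exp (c * t) - 1)) ^ M =
       exp (- (c * t * real M + t * \<Delta>)) * exp (real M * (c * t))"
      by (simp add: True exp_of_nat_mult)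
    also have "\<dots> = exp (- Lam / 1024)"
      by (simp add: exp_add[symmetric] t)
    finally show ?thesis
      using t(1) by (intro exI[of _ t] conjI eq_refl)
  next
    case False
    have less: "weight e i * Lam < thr a"
    proof (rule ccontr)
      assume "\<not> weight e i * Lam < thr a"
      then have "1 \<le> weight e i * Lam / thr a"
        by simp
      with False show False
        by (simp add: q_def keep_prob_def)
    qed
    then have um: "unit_mass e i a = thr a / Lam" and qe: "q = weight e i * Lam / thr a"
      using Lam_pos thr_pos[of a, THEN less_imp_neq]
      by (simp_all add: unit_mass_def q_def keep_prob_def max_absorb2 min_absorb2 field_simps)
    have \<Delta>': "\<Delta> = (real M * q + Lam) / 32"
      unfolding \<Delta> um qe M_def using Lam_pos thr_pos[of a] by (simp add: field_simps del: thr_pos)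
    \<comment> \<open>At \<open>t = 1 / 32\<close> the quadratic term
      \<open>real M * q / 1024\<close> cancels against the matching part of
      \<open>\<Delta> / 32\<close>, and exactly \<open>- Lam / 1024\<close> remains.\<close>
    define s where "s = c / 32"
    have "\<bar>s\<bar> \<le> 1" "s\<^sup>2 = 1 / 1024"
      using c by (auto simp: s_def power2_eq_square)
    then have "exp s - 1 \<le> s + 1 / 1024"
      using exp_le_quadratic[of s] by simp
    moreover have "0 \<le> (1 - q) + q * exp s"
      using q by (intro add_nonneg_nonneg mult_nonneg_nonneg) auto
    then have "0 \<le> 1 + q * (exp s - 1)"
      by (simp add: algebra_simps)
    moreover from calculation q have "q * (exp s - 1) \<le> q * (s + 1 / 1024)"
      by (intro mult_left_mono) auto
    then have "1 + q * (exp s - 1) \<le> exp (q * (s + 1 / 1024))"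
      using exp_ge_add_one_self[of "q * (exp s - 1)"] by (meson exp_le_cancel_iff order_trans)
    ultimately have "(1 + q * (exp s - 1)) ^ M \<le> exp (q * (s + 1 / 1024)) ^ M"
      by (intro power_mono) auto
    also have "\<dots> = exp (real M * q * s + real M * q / 1024)"
      by (simp add: exp_of_nat_mult[symmetric] algebra_simps)
    finally have "exp (- (s * (real M * q) + \<Delta> / 32)) * (1 + q * (exp s - 1)) ^ M \<le>
       exp (- (s * (real M * q) + \<Delta> / 32)) * exp (real M * q * s + real M * q / 1024)"
      by (intro mult_left_mono) auto
    also have "\<dots> = exp (- Lam / 1024)"
      by (simp add: exp_add[symmetric] \<Delta>' field_simps)
    finally show ?thesis
      by (intro exI[of _ "1 / 32"]) (simp add: s_def)
  qed
  then obtain t where t: "t > 0"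
    "exp (- (c * t * (real M * q) + t * \<Delta>)) * (1 + q * (exp (c * t) - 1)) ^ M \<le> exp (- Lam / 1024)"
    by auto
  from order_trans[OF bound[OF t(1)] ennreal_leI[OF t(2)]] show ?thesis
    unfolding q_def M_def .
qed

lemma emeasure_not_accurate:
  assumes "i < n"
  shows "emeasure tapes {r \<in> space tapes. \<not> accurate e r S i a} \<le> ennreal (2 * exp (- Lam / 1024))"
proof (cases "weight e i > 0")
  case False
  then have "weight e i = 0"
    using weight_nonneg[of e i] by linarith
  \<comment> \<open>A zero weight comes from division by zero; positive thresholds then exclude
    every unit, and both counts vanish.\<close>
  then have "\<not> eligible e i a v" "\<not> kept e u i v a" for u v
    using thr_pos[of a] by (auto simp: eligible_def kept_def simp del: thr_pos)
  then have "accurate e r S i a" for r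
    by (simp add: accurate_def eligible_count_def kept_count_def less_imp_le)
  then show ?thesis
    by simp
next
  case True
  define M where "M = real (eligible_count e S i a)"
  define \<Delta> where "\<Delta> = (M * weight e i + thr a) / (32 * unit_mass e i a)"
  let ?D = "\<lambda>r. real (kept_count e r S i a) - M * keep_prob e i a"
  note [measurable] = measurable_tapes_kept_count[OF assms]
  have sub: "\<Delta> \<le> 1 * ?D r \<or> \<Delta> \<le> - 1 * ?D r" if "\<not> accurate e r S i a" for r
  proof -
    have "real (kept_count e r S i a) * unit_mass e i a - M * weight e i = ?D r * unit_mass e i a"
      by (simp add: keep_prob_unit_mass[of e i a, symmetric] algebra_simps)
    moreover have "(M * weight e i + thr a) / 32 = \<Delta> * unit_mass e i a"
      using unit_mass_pos[of e i a] by (simp add: \<Delta>_def field_simps)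
    ultimately have "\<Delta> * unit_mass e i a < \<bar>?D r\<bar> * unit_mass e i a"
      using that unit_mass_pos[of e i a] by (simp add: accurate_def M_def abs_mult)
    then show ?thesis
      using unit_mass_pos[of e i a] by (simp add: mult_less_cancel_right_pos abs_if split: if_splits)
  qed
  have "emeasure tapes {r \<in> space tapes. \<not> accurate e r S i a} \<le>
      emeasure tapes ({r \<in> space tapes. \<Delta> \<le> 1 * ?D r} \<union> {r \<in> space tapes. \<Delta> \<le> - 1 * ?D r})"
    using sub by (intro emeasure_mono) auto
  also have "\<dots> \<le> emeasure tapes {r \<in> space tapes. \<Delta> \<le> 1 * ?D r} + emeasure tapes {r \<in> space tapes. \<Delta> \<le> - 1 * ?D r}"
    by (intro emeasure_subadditive) measurable
  also have "\<dots> \<le> ennreal (exp (- Lam / 1024)) + ennreal (exp (- Lam / 1024))"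
    unfolding M_def
    by (intro add_mono kept_count_one_sided) (use True assms in \<open>simp_all add: \<Delta>_def M_def\<close>)
  also have "\<dots> = ennreal (2 * exp (- Lam / 1024))"
    by (simp add: ennreal_plus[symmetric] del: ennreal_plus)
  finally show ?thesis .
qed

end

section \<open>Message probabilities\<close>

text \<open>In \<open>y powr p = y * y powr (p - 1)\<close> the second factor is at most the
  corresponding power of the whole sum.\<close>

lemma sum_powr_le_powr_sum:
  fixes x :: "'a \<Rightarrow> real"
  assumes "p \<ge> 1" "\<And>a. a \<in> I \<Longrightarrow> 0 \<le> x a"
  shows "(\<Sum>a\<in>I. x a powr p) \<le> (\<Sum>a\<in>I. x a) powr p"
proof (cases "finite I")
  case True
  have *: "y powr p = y * y powr (p - 1)" if "y \<ge> 0" for y :: real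
    using that powr_mult_base[of y "p - 1"] by simp
  have "(\<Sum>a\<in>I. x a powr p) = (\<Sum>a\<in>I. x a * x a powr (p - 1))"
    using assms(2) by (intro sum.cong) (auto simp: *)
  also have "\<dots> \<le> (\<Sum>a\<in>I. x a * (\<Sum>a\<in>I. x a) powr (p - 1))"
    using assms True by (intro sum_mono mult_left_mono powr_mono2 member_le_sum) auto
  also have "\<dots> = (\<Sum>a\<in>I. x a) powr p"
    using assms by (subst *) (auto simp: sum_distrib_right intro: sum_nonneg)
  finally show ?thesis .
qed simp

lemma powr_diff_ge:
  assumes "p \<ge> 1"
  shows "real (Suc c) powr (p - 1) \<le> real (Suc c) powr p - real c powr p"
proof -
  have *: "y powr p = y * y powr (p - 1)" if "y \<ge> 0" for y :: real
    using that powr_mult_base[of y "p - 1"] by simp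
  have "real c powr p \<le> real c * real (Suc c) powr (p - 1)"
    using assms by (subst *) (auto intro!: mult_left_mono powr_mono2)
  then show ?thesis
    by (subst (1) *) (simp_all add: algebra_simps)
qed

section \<open>The moment of the local frequencies and its growth\<close>

context tracker
begin

definition moment :: "stream_updates \<Rightarrow> real" where
  "moment S = (\<Sum>j<k. \<Sum>i<n. real (count_list S (j, i)) powr p)"

lemma moment_snoc:
  assumes "u \<in> {..<k} \<times> {..<n}"
  shows "moment (S @ [u]) = moment S + (real (Suc (count_list S u)) powr p - real (count_list S u) powr p)"
proof -
  obtain j i where u: "u = (j, i)" "j < k" "i < n"
    using assms by (cases u) auto
  have "moment (S @ [u]) = (\<Sum>j'<k. \<Sum>i'<n. real (count_list S (j', i')) powr p +
     (if j' = j then if i' = i then real (Suc (count_list S u)) powr p - real (count_list S u) powr p else 0 else 0))"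
    unfolding moment_def by (intro sum.cong refl) (auto simp: u add.commute)
  also have "\<dots> = moment S + (\<Sum>j'<k. \<Sum>i'<n.
     if j' = j then if i' = i then real (Suc (count_list S u)) powr p - real (count_list S u) powr p else 0 else 0)"
    by (simp only: moment_def sum.distrib)
  also have "\<dots> = moment S + (\<Sum>j'<k. if j' = j then real (Suc (count_list S u)) powr p - real (count_list S u) powr p else 0)"
    using u by (intro arg_cong2[of _ _ _ _ "(+)"] sum.cong refl) auto
  also have "\<dots> = moment S + (real (Suc (count_list S u)) powr p - real (count_list S u) powr p)"
    using u by simp
  finally show ?thesis .
qed

lemma moment_Nil [simp]: "moment [] = 0"
  using p_ge_1 by (simp add: moment_def)

lemma moment_mono:
  assumes "u \<in> {..<k} \<times> {..<n}"
  shows "moment S \<le> moment (S @ [u])"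
proof -
  have "0 \<le> real (Suc (count_list S u)) powr p - real (count_list S u) powr p"
    by (rule order_trans[OF _ powr_diff_ge[OF p_ge_1]]) simp
  then show ?thesis
    unfolding moment_snoc[OF assms] by linarith
qed

lemma moment_ge_1:
  assumes "set S \<subseteq> {..<k} \<times> {..<n}" "S \<noteq> []"
  shows "1 \<le> moment S"
  using assms
proof (induction S rule: rev_induct)
  case (snoc u S)
  show ?case
  proof (cases "S = []")
    case True
    have "moment ([] @ [u]) = 1"
      using snoc.prems p_ge_1 by (subst moment_snoc) auto
    then show ?thesis
      using True by simp
  next
    case False
    then show ?thesis
      using snoc moment_mono[of u S] by auto
  qed
qed simp

lemma moment_le_freq: "moment S \<le> (\<Sum>i<n. real (freq k S i) powr p)"
proof -
  have "moment S = (\<Sum>i<n. \<Sum>j<k. real (count_list S (j, i)) powr p)"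
    unfolding moment_def by (rule sum.swap)
  also have "\<dots> \<le> (\<Sum>i<n. (\<Sum>j<k. real (count_list S (j, i))) powr p)"
    using p_ge_1 by (intro sum_mono sum_powr_le_powr_sum) auto
  finally show ?thesis
    by (simp add: freq_def local_freq_def)
qed

lemma sum_freq:
  assumes "set S \<subseteq> {..<k} \<times> {..<n}"
  shows "(\<Sum>i<n. freq k S i) = length S"
  using assms
proof (induction S rule: rev_induct)
  case (snoc u S)
  then have "(\<Sum>i<n. freq k (S @ [u]) i) = (\<Sum>i<n. freq k S i + (if i = snd u then 1 else 0))"
    by (intro sum.cong) (auto simp: freq_snoc)
  then show ?case
    using snoc by (auto simp: sum.distrib)
qed (simp add: freq_def local_freq_def)

lemma moment_le_length:
  assumes "set S \<subseteq> {..<k} \<times> {..<n}"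
  shows "moment S \<le> real (length S) powr p"
proof -
  have "moment S \<le> (\<Sum>i<n. real (freq k S i) powr p)"
    by (rule moment_le_freq)
  also have "\<dots> \<le> (\<Sum>i<n. real (freq k S i)) powr p"
    using p_ge_1 by (intro sum_powr_le_powr_sum) auto
  also have "(\<Sum>i<n. real (freq k S i)) = real (length S)"
    using sum_freq[OF assms] by (metis of_nat_sum)
  finally show ?thesis .
qed

text \<open>A new pair adds 1 to a moment of at least 1; otherwise the local count at most doubles.
  The factor is the price for exchanging the old and new moment in a denominator.\<close>

lemma moment_snoc_le:
  assumes S: "set S \<subseteq> {..<k} \<times> {..<n}" "S \<noteq> []" and u: "u \<in> {..<k} \<times> {..<n}"
  shows "moment (S @ [u]) \<le> 2 powr p * moment S"
proof (cases "count_list S u = 0")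
  case True
  have "moment (S @ [u]) = moment S + 1"
    using True p_ge_1 by (simp add: moment_snoc[OF u])
  also have "\<dots> \<le> 2 * moment S"
    using moment_ge_1[OF S] by simp
  also have "\<dots> \<le> 2 powr p * moment S"
    using moment_ge_1[OF S] powr_mono[of 1 p 2] p_ge_1 by (intro mult_right_mono) auto
  finally show ?thesis .
next
  case False
  obtain j i where ji: "u = (j, i)" "j < k" "i < n"
    using u by (cases u) auto
  let ?c = "real (count_list S u)"
  have "real (Suc (count_list S u)) powr p \<le> (2 * ?c) powr p"
    using False p_ge_1 by (intro powr_mono2) auto
  then have *: "real (Suc (count_list S u)) powr p \<le> 2 powr p * ?c powr p"
    by (simp add: powr_mult)
  have "?c powr p \<le> (\<Sum>i<n. real (count_list S (j, i)) powr p)"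
    unfolding ji(1) using ji by (intro member_le_sum[of i "{..<n}" "\<lambda>i. real (count_list S (j, i)) powr p"]) auto
  also have "\<dots> \<le> moment S"
    unfolding moment_def using ji
    by (intro member_le_sum[of j "{..<k}" "\<lambda>j. \<Sum>i<n. real (count_list S (j, i)) powr p"]) (auto intro: sum_nonneg)
  finally have "0 \<le> moment S - ?c powr p"
    by simp
  then have "1 * (moment S - ?c powr p) \<le> 2 powr p * (moment S - ?c powr p)"
    using p_ge_1 by (intro mult_right_mono) (auto simp: ge_one_powr_ge_zero)
  then show ?thesis
    using * by (simp add: moment_snoc[OF u] algebra_simps)
qed

text \<open>Summed over the stream, the message probabilities telescope to the logarithm of the moment.\<close>

lemma count_powr_le_ln_moment:
  assumes S: "set S \<subseteq> {..<k} \<times> {..<n}" "S \<noteq> []" and u: "u \<in> {..<k} \<times> {..<n}"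
  shows "real (Suc (count_list S u)) powr (p - 1) / moment S \<le>
           2 powr p * (ln (moment (S @ [u])) - ln (moment S))"
proof -
  let ?H = "moment S" and ?H' = "moment (S @ [u])"
  have H: "1 \<le> ?H" "?H \<le> ?H'"
    using moment_ge_1[OF S] moment_mono[OF u] by auto
  have "real (Suc (count_list S u)) powr (p - 1) / ?H \<le> (?H' - ?H) / ?H"
    using H powr_diff_ge[OF p_ge_1, of "count_list S u"]
    by (intro divide_right_mono) (auto simp: moment_snoc[OF u])
  \<comment> \<open>The bound \<open>1 - y \<le> - ln y\<close> yields a difference of logarithms
    only with the new moment in the denominator.\<close>
  also have "\<dots> \<le> (?H' - ?H) / (?H' / 2 powr p)"
    using H moment_snoc_le[OF S u] by (intro divide_left_mono) (auto simp: field_simps)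
  also have "\<dots> = 2 powr p * (1 - ?H / ?H')"
    using H by (simp add: field_simps)
  also have "\<dots> \<le> 2 powr p * - ln (?H / ?H')"
    using H ln_le_minus_one[of "?H / ?H'"] by (intro mult_left_mono) auto
  also have "- ln (?H / ?H') = ln ?H' - ln ?H"
    using H by (simp add: ln_div)
  finally show ?thesis .
qed

section \<open>Probabilities on the joint sample space\<close>

lemma measurable_randomness_exponential:
  "i < n \<Longrightarrow> (\<lambda>\<omega>. fst \<omega> i) \<in> borel_measurable (randomness n k)"
proof -
  assume "i < n"
  then have "(\<lambda>e. e i) \<in> measurable exponentials std_exponential"
    by (intro measurable_component_singleton) simp
  then have "(\<lambda>e. e i) \<in> borel_measurable exponentials"
    by simp
  then show ?thesis
    unfolding randomness_def by (rule measurable_compose[OF measurable_fst])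
qed

lemma measurable_randomness_tape:
  "j < k \<Longrightarrow> (\<lambda>\<omega>. fst (snd \<omega>) j m) \<in> borel_measurable (randomness n k)"
proof -
  assume "j < k"
  then have "(\<lambda>r. fst r j m) \<in> borel_measurable (tapes \<Otimes>\<^sub>M tape_measure)"
    by (intro measurable_compose[OF measurable_fst] measurable_tapes_component)
  then show ?thesis
    unfolding randomness_def by (rule measurable_compose[OF measurable_snd])
qed

text \<open>Fubini with the exponentials outside: the tapes are bounded for each fixed
  \<open>e\<close>, and the coordinator's tape integrates to 1.\<close>

lemma emeasure_randomness_le:
  assumes Q: "Measurable.pred (randomness n k) (\<lambda>\<omega>. Q (fst \<omega>) (fst (snd \<omega>)))"
    and Q': "\<And>e. {r \<in> space tapes. Q e r} \<in> sets tapes"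
    and le: "\<And>e. emeasure tapes {r \<in> space tapes. Q e r} \<le> f e"
  shows "emeasure (randomness n k) {\<omega> \<in> space (randomness n k). Q (fst \<omega>) (fst (snd \<omega>))} \<le> (\<integral>\<^sup>+e. f e \<partial>exponentials)"
proof -
  interpret TT: prob_space "tapes \<Otimes>\<^sub>M tape_measure"
    by (intro prob_space_pair prob_space_tapes prob_space_tape)
  interpret T: prob_space tape_measure
    by (rule prob_space_tape)
  let ?X = "{\<omega> \<in> space (randomness n k). Q (fst \<omega>) (fst (snd \<omega>))}"
  have "?X \<in> sets (randomness n k)"
    using Q by measurable
  then have "emeasure (randomness n k) ?X = (\<integral>\<^sup>+e. emeasure (tapes \<Otimes>\<^sub>M tape_measure) (Pair e -` ?X) \<partial>exponentials)"
    unfolding randomness_def by (rule TT.emeasure_pair_measure_alt)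
  also have "\<dots> \<le> (\<integral>\<^sup>+e. f e \<partial>exponentials)"
  proof (intro nn_integral_mono)
    fix e assume e: "e \<in> space exponentials"
    have "Pair e -` ?X = {r \<in> space tapes. Q e r} \<times> space tape_measure"
      using e by (auto simp: randomness_def space_pair_measure)
    then show "emeasure (tapes \<Otimes>\<^sub>M tape_measure) (Pair e -` ?X) \<le> f e"
      using le[of e] T.emeasure_space_1 T.emeasure_pair_measure_Times[OF Q' sets.top] by simp
  qed
  finally show ?thesis .
qed

lemma emeasure_randomness_exponentials_le:
  assumes Q: "Measurable.pred exponentials Q"
  shows "emeasure (randomness n k) {\<omega> \<in> space (randomness n k). Q (fst \<omega>)} \<le> emeasure exponentials {e \<in> space exponentials. Q e}"
proof -
  interpret prob_space tapes
    by (rule prob_space_tapes)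
  have set: "{e \<in> space exponentials. Q e} \<in> sets exponentials"
    using Q by measurable
  have "emeasure (randomness n k) {\<omega> \<in> space (randomness n k). Q (fst \<omega>)} \<le> (\<integral>\<^sup>+e. (if Q e then 1 else 0) \<partial>exponentials)"
  proof (rule emeasure_randomness_le)
    show "Measurable.pred (randomness n k) (\<lambda>\<omega>. Q (fst \<omega>))"
      unfolding randomness_def by (rule measurable_compose[OF measurable_fst Q])
  qed (auto simp: emeasure_space_1)
  also have "\<dots> = (\<integral>\<^sup>+e. indicator {e \<in> space exponentials. Q e} e \<partial>exponentials)"
    by (intro nn_integral_cong) (auto split: split_indicator)
  also have "\<dots> = emeasure exponentials {e \<in> space exponentials. Q e}"
    using set by simp
  finally show ?thesis .
qed

lemma emeasure_randomness_not_accurate: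
  assumes "i < n"
  shows "emeasure (randomness n k) {\<omega> \<in> space (randomness n k). \<not> accurate (fst \<omega>) (fst (snd \<omega>)) S i a}
           \<le> ennreal (2 * exp (- Lam / 1024))"
proof -
  interpret prob_space exponentials
    by (rule prob_space_exponentials)
  have "emeasure (randomness n k) {\<omega> \<in> space (randomness n k). \<not> accurate (fst \<omega>) (fst (snd \<omega>)) S i a}
     \<le> (\<integral>\<^sup>+e. ennreal (2 * exp (- Lam / 1024)) \<partial>exponentials)"
  proof (rule emeasure_randomness_le)
    have "Measurable.pred (randomness n k) (\<lambda>\<omega>. accurate (fst \<omega>) (fst (snd \<omega>)) S i a)"
      by (intro pred_accurate measurable_randomness_exponential measurable_randomness_tape assms)
    then show "Measurable.pred (randomness n k) (\<lambda>\<omega>. \<not> accurate (fst \<omega>) (fst (snd \<omega>)) S i a)"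
      by measurable
    have "Measurable.pred tapes (\<lambda>r. accurate e r S i a)" for e
      by (intro pred_accurate[where e = "\<lambda>_. e"] measurable_tapes_component assms) auto
    then show "{r \<in> space tapes. \<not> accurate e r S i a} \<in> sets tapes" for e
      by measurable
  qed (rule emeasure_not_accurate[OF assms])
  then show ?thesis
    by (simp add: emeasure_space_1)
qed

lemma emeasure_randomness_scaled_freq_less:
  assumes "0 < x"
  shows "emeasure (randomness n k) {\<omega> \<in> space (randomness n k). \<forall>i<n. scaled_freq p k (fst \<omega>) S i < x}
           \<le> ennreal (exp (- moment S / x powr p))"
proof -
  have eq: "(\<forall>i<n. scaled_freq p k e S i < x) \<longleftrightarrow> (\<forall>i<n. real (freq k S i) * (1 / e i powr (1 / p)) < x)" for e
    by (simp add: scaled_freq_def)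
  have "emeasure (randomness n k) {\<omega> \<in> space (randomness n k). \<forall>i<n. scaled_freq p k (fst \<omega>) S i < x}
     \<le> emeasure exponentials {e \<in> space exponentials. \<forall>i<n. scaled_freq p k e S i < x}"
  proof (rule emeasure_randomness_exponentials_le)
    have [measurable]: "(\<lambda>e. e i) \<in> borel_measurable exponentials" if "i \<in> {..<n}" for i
      using measurable_component_singleton[of i "{..<n}" "\<lambda>_. std_exponential"] that by simp
    have "Measurable.pred exponentials (\<lambda>e. \<forall>i\<in>{..<n}. scaled_freq p k e S i < x)"
      unfolding scaled_freq_def by measurable
    then show "Measurable.pred exponentials (\<lambda>e. \<forall>i<n. scaled_freq p k e S i < x)"
      unfolding Ball_def lessThan_iff .
  qed
  also have "\<dots> \<le> ennreal (exp (- (\<Sum>i<n. real (freq k S i) powr p) / x powr p))"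
    unfolding eq using p_ge_1 assms by (intro emeasure_scaled_all_less) auto
  also have "\<dots> \<le> ennreal (exp (- moment S / x powr p))"
    using moment_le_freq[of S] assms by (intro ennreal_leI) (simp add: divide_right_mono)
  finally show ?thesis .
qed

lemma emeasure_randomness_outside:
  assumes "0 \<le> lo" "0 \<le> hi"
  shows "emeasure (randomness n k) {\<omega> \<in> space (randomness n k). \<not> (\<forall>i<n. lo \<le> fst \<omega> i \<and> fst \<omega> i \<le> hi)}
           \<le> ennreal (real n * (lo + exp (- hi)))"
proof -
  interpret product_prob_space "\<lambda>_::nat. std_exponential" "{..<n}"
    by (rule product_prob_spaceI) (rule prob_space_std_exponential)
  have meas: "(\<lambda>e. e i) \<in> borel_measurable exponentials" if "i < n" for i
    using measurable_component_singleton[of i "{..<n}" "\<lambda>_. std_exponential"] that by simp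
  let ?O = "\<lambda>i. {e \<in> space exponentials. e i \<in> - {lo..hi}}"
  have O: "?O i \<in> sets exponentials" if "i < n" for i
    using meas[OF that] by measurable
  have "emeasure (randomness n k) {\<omega> \<in> space (randomness n k). \<not> (\<forall>i<n. lo \<le> fst \<omega> i \<and> fst \<omega> i \<le> hi)}
     \<le> emeasure exponentials {e \<in> space exponentials. \<not> (\<forall>i<n. lo \<le> e i \<and> e i \<le> hi)}"
  proof (rule emeasure_randomness_exponentials_le)
    note [measurable] = meas
    have "Measurable.pred exponentials (\<lambda>e. \<not> (\<forall>i\<in>{..<n}. lo \<le> e i \<and> e i \<le> hi))"
      by measurable
    then show "Measurable.pred exponentials (\<lambda>e. \<not> (\<forall>i<n. lo \<le> e i \<and> e i \<le> hi))"
      unfolding Ball_def lessThan_iff .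
  qed
  also have "{e \<in> space exponentials. \<not> (\<forall>i<n. lo \<le> e i \<and> e i \<le> hi)} = (\<Union>i<n. ?O i)"
    by auto
  also have "emeasure exponentials (\<Union>i<n. ?O i) \<le> (\<Sum>i<n. emeasure exponentials (?O i))"
    using O by (intro emeasure_subadditive_finite) auto
  also have "\<dots> \<le> (\<Sum>i<n. ennreal (lo + exp (- hi)))"
    using assms emeasure_std_exponential_outside[of lo hi]
    by (intro sum_mono) (subst emeasure_PiM_Collect_single, auto)
  also have "\<dots> = ennreal (real n * (lo + exp (- hi)))"
    using assms by (simp add: ennreal_mult ennreal_of_nat_eq_real_of_nat)
  finally show ?thesis .
qed

text \<open>With a constant threshold \<open>\<tau>\<close> the event involves one exponential and
  one tape cell. Given \<open>e\<close>, the cell contributes at most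
  \<open>weight e i * Lam / \<tau>\<close>; the cutoff says \<open>e i powr (1 / p) \<le> B\<close>,
  so the truncated integral applies.\<close>

lemma emeasure_randomness_keep:
  assumes "i < n" "j < k" "0 < \<tau>" "0 < lo" "lo \<le> hi" "v > 0"
  shows "emeasure (randomness n k) {\<omega> \<in> space (randomness n k). lo \<le> fst \<omega> i \<and> fst \<omega> i \<le> hi \<and>
            fst (snd \<omega>) j m \<le> weight (fst \<omega>) i * Lam / \<tau> \<and> \<tau> \<le> 32 * real k * (real v * weight (fst \<omega>) i)}
         \<le> ennreal (Lam / \<tau> * ((32 * real k * real v / \<tau>) powr (p - 1) * ln (hi / lo)))"
proof -
  define B where "B = 32 * real k * real v / \<tau>"
  have B: "B > 0"
    using assms k_ge_1 by (simp add: B_def)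
  let ?I = "{x. lo \<le> x \<and> x \<le> hi \<and> x powr (1 / p) \<le> B}"
  define F where "F = (\<lambda>x. ennreal (1 / x powr (1 / p)) * indicator ?I x)"
  have [measurable]: "F \<in> borel_measurable borel"
    unfolding F_def by measurable
  define Q where "Q = (\<lambda>e (r :: nat \<Rightarrow> nat \<Rightarrow> real). lo \<le> e i \<and> e i \<le> hi \<and>
            r j m \<le> weight e i * Lam / \<tau> \<and> \<tau> \<le> 32 * real k * (real v * weight e i))"
  have "emeasure (randomness n k) {\<omega> \<in> space (randomness n k). Q (fst \<omega>) (fst (snd \<omega>))} \<le>
     (\<integral>\<^sup>+e. ennreal (Lam / \<tau>) * F (e i) \<partial>exponentials)"
  proof (rule emeasure_randomness_le)
    note [measurable] = measurable_randomness_exponential[OF assms(1)] measurable_randomness_tape[OF assms(2)]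
    show "Measurable.pred (randomness n k) (\<lambda>\<omega>. Q (fst \<omega>) (fst (snd \<omega>)))"
      unfolding Q_def weight_def by measurable
    fix e :: "nat \<Rightarrow> real"
    note [measurable] = measurable_tapes_component[OF assms(2)]
    show sets: "{r \<in> space tapes. Q e r} \<in> sets tapes"
      unfolding Q_def by measurable
    show "emeasure tapes {r \<in> space tapes. Q e r} \<le> ennreal (Lam / \<tau>) * F (e i)"
    proof (cases "lo \<le> e i \<and> e i \<le> hi \<and> \<tau> \<le> 32 * real k * (real v * weight e i)")
      case True
      then have e: "e i > 0"
        using assms by simp
      then have "e i \<in> ?I"
        using True assms e pos_le_divide_eq[of "e i powr (1 / p)" \<tau> "32 * real k * real v"]
        by (simp add: B_def weight_def pos_le_divide_eq mult.commute mult.left_commute)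
      then have "ennreal (Lam / \<tau>) * F (e i) = ennreal (weight e i * Lam / \<tau>)"
        using Lam_pos assms by (simp add: F_def weight_def ennreal_mult[symmetric])
      moreover have "emeasure tapes {r \<in> space tapes. Q e r} \<le> emeasure tapes {r \<in> space tapes. r j m \<le> weight e i * Lam / \<tau>}"
        by (intro emeasure_mono) (auto simp: Q_def)
      moreover have "\<dots> \<le> ennreal (weight e i * Lam / \<tau>)"
        using assms Lam_pos by (intro emeasure_tapes_atMost) auto
      ultimately show ?thesis
        by simp
    next
      case False
      then have empty: "{r \<in> space tapes. Q e r} = {}"
        by (auto simp: Q_def)
      show ?thesis
        unfolding empty by simp
    qed
  qed
  also have "\<dots> = (\<integral>\<^sup>+x. ennreal (Lam / \<tau>) * F x \<partial>std_exponential)"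
    by (rule nn_integral_exponentials_component[OF assms(1)]) measurable
  also have "\<dots> = ennreal (Lam / \<tau>) * (\<integral>\<^sup>+x. F x \<partial>std_exponential)"
    by (rule nn_integral_cmult) simp
  also have "\<dots> \<le> ennreal (Lam / \<tau>) * ennreal (B powr (p - 1) * ln (hi / lo))"
    unfolding F_def using p_ge_1 assms B by (intro mult_left_mono nn_integral_exponential_powr_le) auto
  also have "\<dots> = ennreal (Lam / \<tau> * (B powr (p - 1) * ln (hi / lo)))"
    using Lam_pos assms by (intro ennreal_mult[symmetric]) auto
  finally show ?thesis
    unfolding Q_def B_def .
qed

end

section \<open>Success probability and expected communication\<close>

text \<open>The interval from \<open>lo\<close> to \<open>hi\<close> is where all exponentials
  should lie, \<open>m\<close> bounds the stream length, and \<open>exp (- \<theta>)\<close> is the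
  tolerated probability of an atypically small maximum.\<close>

locale calibrated_tracker = tracker +
  fixes lo hi \<theta> :: real and m :: nat
  assumes lo_pos: "0 < lo" and lo_le_hi: "lo \<le> hi" and \<theta>_pos: "0 < \<theta>"
    and base_le_weight: "\<And>x. lo \<le> x \<Longrightarrow> x \<le> hi \<Longrightarrow> base \<le> 1 / x powr (1 / p)"
    and weight_le_thr: "\<And>x. lo \<le> x \<Longrightarrow> x \<le> hi \<Longrightarrow> real m * (1 / x powr (1 / p)) \<le> thr A / 2"
begin

definition range_failure :: real where
  "range_failure = real n * (lo + exp (- hi))"

definition accuracy_failure :: real where
  "accuracy_failure = real n * (real A * (2 * exp (- Lam / 1024)))"

text \<open>The factor of \<open>v powr (p - 1) / moment S\<close> in the report probability:
  \<open>\<theta>\<close> and \<open>4 powr p\<close> come from the lower bound on the threshold,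
  the powers of 32 and \<open>k\<close> from the cutoff, and the logarithm from the truncated
  integral.\<close>

definition message_rate :: real where
  "message_rate = Lam * \<theta> * ln (hi / lo) * 32 powr (p - 1) * 4 powr p * real k powr (p - 1)"

lemma message_rate_nonneg: "0 \<le> message_rate"
  using Lam_pos \<theta>_pos lo_pos lo_le_hi by (simp add: message_rate_def)

abbreviation (input) in_box :: "(nat \<Rightarrow> real) \<Rightarrow> bool" where
  "in_box e \<equiv> \<forall>i<n. lo \<le> e i \<and> e i \<le> hi"

definition fails_range :: "sample set" where
  "fails_range = {\<omega> \<in> space (randomness n k). \<not> in_box (fst \<omega>)}"

definition fails_accuracy :: "stream_updates \<Rightarrow> sample set" where
  "fails_accuracy S = {\<omega> \<in> space (randomness n k). \<not> all_accurate (fst \<omega>) (fst (snd \<omega>)) S}"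

lemma in_box_in_range:
  assumes "in_box e" "length S \<le> m"
  shows "in_range e S"
  unfolding in_range_def
proof (intro allI impI conjI)
  fix i assume i: "i < n"
  then show "base \<le> weight e i"
    using assms base_le_weight[of "e i"] by (simp add: weight_def)
  have "real (length S) * weight e i \<le> real m * weight e i"
    using assms by (intro mult_right_mono) auto
  also have "\<dots> \<le> thr A / 2"
    using assms weight_le_thr[of "e i"] i by (simp add: weight_def)
  finally show "real (length S) * weight e i \<le> thr A / 2" .
qed

lemma sets_fails_range: "fails_range \<in> sets (randomness n k)"
proof -
  have [measurable]: "(\<lambda>\<omega>. fst \<omega> i) \<in> borel_measurable (randomness n k)" if "i \<in> {..<n}" for i
    using measurable_randomness_exponential that by simp
  have "{\<omega> \<in> space (randomness n k). \<not> (\<forall>i\<in>{..<n}. lo \<le> fst \<omega> i \<and> fst \<omega> i \<le> hi)} \<in> sets (randomness n k)"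
    by measurable
  then show ?thesis
    unfolding fails_range_def Ball_def lessThan_iff .
qed

lemma emeasure_fails_range: "emeasure (randomness n k) fails_range \<le> ennreal range_failure"
  unfolding range_failure_def fails_range_def using lo_pos lo_le_hi by (intro emeasure_randomness_outside) auto

lemma fails_accuracy_eq: "fails_accuracy S =
    (\<Union>i<n. \<Union>a<A. {\<omega> \<in> space (randomness n k). \<not> accurate (fst \<omega>) (fst (snd \<omega>)) S i a})"
  by (auto simp: fails_accuracy_def all_accurate_def)

lemma sets_not_accurate:
  assumes "i < n"
  shows "{\<omega> \<in> space (randomness n k). \<not> accurate (fst \<omega>) (fst (snd \<omega>)) S i a} \<in> sets (randomness n k)"
proof -
  have "Measurable.pred (randomness n k) (\<lambda>\<omega>. accurate (fst \<omega>) (fst (snd \<omega>)) S i a)"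
    by (intro pred_accurate measurable_randomness_exponential measurable_randomness_tape assms)
  then show ?thesis
    by measurable
qed

lemma sets_fails_accuracy: "fails_accuracy S \<in> sets (randomness n k)"
  unfolding fails_accuracy_eq using sets_not_accurate by (intro sets.finite_UN) auto

lemma emeasure_fails_accuracy: "emeasure (randomness n k) (fails_accuracy S) \<le> ennreal accuracy_failure"
proof -
  let ?N = "\<lambda>i a. {\<omega> \<in> space (randomness n k). \<not> accurate (fst \<omega>) (fst (snd \<omega>)) S i a}"
  have "emeasure (randomness n k) (fails_accuracy S) \<le> (\<Sum>i<n. emeasure (randomness n k) (\<Union>a<A. ?N i a))"
    unfolding fails_accuracy_eq using sets_not_accurate by (intro emeasure_subadditive_finite) (auto intro!: sets.finite_UN)
  also have "\<dots> \<le> (\<Sum>i<n. \<Sum>a<A. emeasure (randomness n k) (?N i a))"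
    using sets_not_accurate by (intro sum_mono emeasure_subadditive_finite) auto
  also have "\<dots> \<le> (\<Sum>i<n. \<Sum>a<A. ennreal (2 * exp (- Lam / 1024)))"
    by (intro sum_mono emeasure_randomness_not_accurate) auto
  also have "\<dots> = ennreal accuracy_failure"
    by (simp add: accuracy_failure_def ennreal_mult ennreal_of_nat_eq_real_of_nat)
  finally show ?thesis .
qed

lemma correct_now_iff:
  assumes "set S \<subseteq> {..<k} \<times> {..<n}"
  shows "correct_now p n k tracking_protocol S \<omega> \<longleftrightarrow>
     valid_PL n (scaled_freq p k (fst \<omega>) S)
       (coord_out tracking_protocol (fst \<omega>) (snd (snd \<omega>)) (hist (fst \<omega>) (fst (snd \<omega>)) S))"
  using run_Some[OF assms, of "fst \<omega>" "fst (snd \<omega>)" "snd (snd \<omega>)"] by (cases \<omega>) auto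

lemma sets_correct_always:
  assumes "set S \<subseteq> {..<k} \<times> {..<n}"
  shows "{\<omega> \<in> space (randomness n k). correct_always p n k tracking_protocol S \<omega>} \<in> sets (randomness n k)"
proof -
  have "Measurable.pred (randomness n k) (correct_now p n k tracking_protocol (take t S))" for t
  proof -
    have S: "set (take t S) \<subseteq> {..<k} \<times> {..<n}"
      using assms set_take_subset by fast
    show ?thesis
      unfolding correct_now_iff[OF S, abs_def]
      by (intro pred_valid_output[OF _ _ S] measurable_randomness_exponential measurable_randomness_tape)
  qed
  then have "Measurable.pred (randomness n k) (\<lambda>\<omega>. \<forall>t\<in>{..length S}. correct_now p n k tracking_protocol (take t S) \<omega>)"
    by (intro pred_intros_finite) auto
  then show ?thesis
    unfolding correct_always_def pred_def Ball_def atMost_iff .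
qed

text \<open>The range event concerns the exponentials only and is charged once; accuracy is charged
  for each of the at most \<open>Suc m\<close> prefixes, the empty one included.\<close>

lemma measure_correct_always:
  assumes S: "set S \<subseteq> {..<k} \<times> {..<n}" "length S \<le> m"
  shows "measure (randomness n k) {\<omega> \<in> space (randomness n k). correct_always p n k tracking_protocol S \<omega>}
     \<ge> 1 - (range_failure + real (Suc m) * accuracy_failure)"
proof -
  interpret prob_space "randomness n k"
    by (rule prob_space_randomness)
  let ?C = "{\<omega> \<in> space (randomness n k). correct_always p n k tracking_protocol S \<omega>}"
  have nonneg: "0 \<le> range_failure" "0 \<le> accuracy_failure"
    using lo_pos by (auto simp: range_failure_def accuracy_failure_def)
  have "space (randomness n k) - ?C \<subseteq> fails_range \<union> (\<Union>t\<in>{..length S}. fails_accuracy (take t S))"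
  proof
    fix \<omega> assume \<omega>: "\<omega> \<in> space (randomness n k) - ?C"
    then obtain t where t: "t \<le> length S" "\<not> correct_now p n k tracking_protocol (take t S) \<omega>"
      by (auto simp: correct_always_def)
    have "set (take t S) \<subseteq> {..<k} \<times> {..<n}"
      using S set_take_subset by fast
    from correct_nowI[OF this, of "fst \<omega>" "fst (snd \<omega>)" "snd (snd \<omega>)"] t
    have "\<not> all_accurate (fst \<omega>) (fst (snd \<omega>)) (take t S) \<or> \<not> in_range (fst \<omega>) (take t S)"
      by (cases \<omega>) auto
    then have "\<not> all_accurate (fst \<omega>) (fst (snd \<omega>)) (take t S) \<or> \<not> in_box (fst \<omega>)"
      using in_box_in_range[of "fst \<omega>" "take t S"] S t by auto
    then show "\<omega> \<in> fails_range \<union> (\<Union>t\<in>{..length S}. fails_accuracy (take t S))"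
      using \<omega> t by (auto simp: fails_range_def fails_accuracy_def)
  qed
  then have "emeasure (randomness n k) (space (randomness n k) - ?C) \<le>
      emeasure (randomness n k) (fails_range \<union> (\<Union>t\<in>{..length S}. fails_accuracy (take t S)))"
    using sets_fails_range sets_fails_accuracy by (intro emeasure_mono) auto
  also have "\<dots> \<le> emeasure (randomness n k) fails_range + emeasure (randomness n k) (\<Union>t\<in>{..length S}. fails_accuracy (take t S))"
    using sets_fails_range sets_fails_accuracy by (intro emeasure_subadditive) auto
  also have "\<dots> \<le> emeasure (randomness n k) fails_range + (\<Sum>t\<le>length S. emeasure (randomness n k) (fails_accuracy (take t S)))"
    using sets_fails_accuracy by (intro add_left_mono emeasure_subadditive_finite) auto
  also have "\<dots> \<le> ennreal range_failure + (\<Sum>t\<le>length S. ennreal accuracy_failure)"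
    by (intro add_mono sum_mono emeasure_fails_range emeasure_fails_accuracy)
  also have "\<dots> = ennreal (range_failure + real (Suc (length S)) * accuracy_failure)"
    using nonneg by (simp add: ennreal_mult ennreal_of_nat_eq_real_of_nat[symmetric] del: of_nat_Suc)
  also have "\<dots> \<le> ennreal (range_failure + real (Suc m) * accuracy_failure)"
    using nonneg S by (intro ennreal_leI add_left_mono mult_right_mono) auto
  finally have "ennreal (prob (space (randomness n k) - ?C)) \<le> ennreal (range_failure + real (Suc m) * accuracy_failure)"
    unfolding emeasure_eq_measure .
  then have "prob (space (randomness n k) - ?C) \<le> range_failure + real (Suc m) * accuracy_failure"
    by (subst (asm) ennreal_le_iff) (use nonneg in auto)
  then show ?thesis
    using prob_compl[OF sets_correct_always[OF S(1)]] by linarith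
qed

section \<open>Expected number of reports and bits\<close>

lemma measurable_randomness_hist:
  assumes "set S \<subseteq> {..<k} \<times> {..<n}"
  shows "(\<lambda>\<omega>. hist (fst \<omega>) (fst (snd \<omega>)) S) \<in> measurable (randomness n k) (count_space UNIV)"
  by (intro measurable_hist measurable_randomness_exponential measurable_randomness_tape assms)

lemma pred_sends:
  assumes "set S \<subseteq> {..<k} \<times> {..<n}" "u \<in> {..<k} \<times> {..<n}"
  shows "Measurable.pred (randomness n k) (\<lambda>\<omega>. sends (fst \<omega>) (fst (snd \<omega>)) S u)"
  unfolding sends_def
proof (rule measurable_compose_countable[OF _ measurable_randomness_hist[OF assms(1)]])
  fix h
  show "Measurable.pred (randomness n k) (\<lambda>\<omega>. kept (fst \<omega>)
      (fst (snd \<omega>) (fst u) (prod_encode (snd u, Suc (count_list S u)))) (snd u) (Suc (count_list S u)) (level (fst \<omega>) h))"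
    using assms by (intro pred_kept_level measurable_randomness_exponential measurable_randomness_tape) auto
qed

text \<open>Off three bad events (range, accuracy, small maximum) the threshold in force is at least
  \<open>\<tau>\<close>, which depends on the stream only. Lowering the threshold weakens both parts
  of the test, so a report implies the event \<open>?K\<close> with constant threshold.\<close>

lemma emeasure_sends:
  assumes S: "set S \<subseteq> {..<k} \<times> {..<n}" "S \<noteq> []" "length S \<le> m" and u: "u \<in> {..<k} \<times> {..<n}"
  shows "emeasure (randomness n k) {\<omega> \<in> space (randomness n k). sends (fst \<omega>) (fst (snd \<omega>)) S u} \<le>
     ennreal (range_failure + accuracy_failure + exp (- \<theta>) +
       message_rate * (real (Suc (count_list S u)) powr (p - 1) / moment S))"
proof -
  obtain j i where ji: "u = (j, i)" "j < k" "i < n"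
    using u by (cases u) auto
  define v where "v = Suc (count_list S u)"
  \<comment> \<open>Chosen so that \<open>moment S / x powr p = \<theta>\<close>.\<close>
  define x where "x = (moment S / \<theta>) powr (1 / p)"
  \<comment> \<open>The 4 is the factor between the maximum and the threshold in force.\<close>
  define \<tau> where "\<tau> = x / 4"
  have H: "moment S \<ge> 1"
    using moment_ge_1 S by auto
  then have x: "x > 0" "x powr p = moment S / \<theta>"
    using \<theta>_pos p_ge_1 by (auto simp: x_def powr_powr)
  then have \<tau>: "\<tau> > 0" "\<tau> powr p = moment S / (\<theta> * 4 powr p)"
    by (auto simp: \<tau>_def powr_divide)
  let ?M = "{\<omega> \<in> space (randomness n k). \<forall>i<n. scaled_freq p k (fst \<omega>) S i < x}"
  let ?K = "{\<omega> \<in> space (randomness n k). lo \<le> fst \<omega> i \<and> fst \<omega> i \<le> hi \<and>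
            fst (snd \<omega>) j (prod_encode (i, v)) \<le> weight (fst \<omega>) i * Lam / \<tau> \<and>
            \<tau> \<le> 32 * real k * (real v * weight (fst \<omega>) i)}"
  have setsM: "?M \<in> sets (randomness n k)"
  proof -
    have [measurable]: "(\<lambda>\<omega>. fst \<omega> i) \<in> borel_measurable (randomness n k)" if "i \<in> {..<n}" for i
      using measurable_randomness_exponential that by simp
    have "{\<omega> \<in> space (randomness n k). \<forall>i\<in>{..<n}. scaled_freq p k (fst \<omega>) S i < x} \<in> sets (randomness n k)"
      unfolding scaled_freq_def by measurable
    then show ?thesis
      unfolding Ball_def lessThan_iff .
  qed
  have setsK: "?K \<in> sets (randomness n k)"
    using measurable_randomness_exponential[OF ji(3)] measurable_randomness_tape[OF ji(2)]
    unfolding weight_def by measurable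
  have "{\<omega> \<in> space (randomness n k). sends (fst \<omega>) (fst (snd \<omega>)) S u} \<subseteq> fails_range \<union> fails_accuracy S \<union> ?M \<union> ?K"
  proof (rule subsetI, rule ccontr)
    fix \<omega> :: sample
    obtain e r s where ers: "\<omega> = (e, r, s)"
      by (cases \<omega>)
    let ?a = "level e (hist e r S)"
    assume "\<omega> \<in> {\<omega> \<in> space (randomness n k). sends (fst \<omega>) (fst (snd \<omega>)) S u}"
      and "\<omega> \<notin> fails_range \<union> fails_accuracy S \<union> ?M \<union> ?K"
    then have \<omega>: "(e, r, s) \<in> space (randomness n k)" and sends: "sends e r S u"
      and "(e, r, s) \<notin> ?K" and box: "(e, r, s) \<notin> fails_range" and acc: "(e, r, s) \<notin> fails_accuracy S"
      and max: "(e, r, s) \<notin> ?M"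
      unfolding ers by simp_all
    have e: "in_box e" "all_accurate e r S"
      using \<omega> box acc by (auto simp: fails_range_def fails_accuracy_def)
    obtain i' where i': "i' < n" "x \<le> scaled_freq p k e S i'"
      using \<omega> max by (auto simp: not_less)
    have "scaled_freq p k e S i' \<le> 4 * thr ?a"
      using scaled_freq_le_thr_level[OF S(1,2) e(2) in_box_in_range[OF e(1) S(3)] i'(1)] .
    then have \<tau>_le: "\<tau> \<le> thr ?a"
      using i' by (simp add: \<tau>_def)
    have kept: "kept e (r j (prod_encode (i, v))) i v ?a"
      using sends by (simp add: sends_def ji v_def)
    have "weight e i * Lam / thr ?a \<le> weight e i * Lam / \<tau>"
      using \<tau>_le \<tau> Lam_pos by (intro divide_left_mono) auto
    then have "(e, r, s) \<in> ?K"
      using \<omega> e ji kept \<tau>_le by (auto simp: kept_def)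
    with \<open>(e, r, s) \<notin> ?K\<close> show False
      by simp
  qed
  then have "emeasure (randomness n k) {\<omega> \<in> space (randomness n k). sends (fst \<omega>) (fst (snd \<omega>)) S u} \<le>
     emeasure (randomness n k) (fails_range \<union> fails_accuracy S \<union> ?M \<union> ?K)"
    by (rule emeasure_mono) (intro sets.Un setsM setsK sets_fails_range sets_fails_accuracy)
  also have "\<dots> \<le> emeasure (randomness n k) (fails_range \<union> fails_accuracy S \<union> ?M) + emeasure (randomness n k) ?K"
    by (intro emeasure_subadditive sets.Un setsM setsK sets_fails_range sets_fails_accuracy)
  also have "\<dots> \<le> emeasure (randomness n k) (fails_range \<union> fails_accuracy S) + emeasure (randomness n k) ?M + emeasure (randomness n k) ?K"
    by (intro add_right_mono emeasure_subadditive sets.Un setsM setsK sets_fails_range sets_fails_accuracy)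
  also have "\<dots> \<le> emeasure (randomness n k) fails_range + emeasure (randomness n k) (fails_accuracy S) +
      emeasure (randomness n k) ?M + emeasure (randomness n k) ?K"
    by (intro add_right_mono emeasure_subadditive sets.Un setsM setsK sets_fails_range sets_fails_accuracy)
  also have "\<dots> \<le> ennreal range_failure + ennreal accuracy_failure + ennreal (exp (- \<theta>)) +
      ennreal (message_rate * (real v powr (p - 1) / moment S))"
  proof (intro add_mono emeasure_fails_range emeasure_fails_accuracy)
    show "emeasure (randomness n k) ?M \<le> ennreal (exp (- \<theta>))"
      using emeasure_randomness_scaled_freq_less[OF x(1), of S] x(2) H \<theta>_pos by simp
    have "emeasure (randomness n k) ?K \<le> ennreal (Lam / \<tau> * ((32 * real k * real v / \<tau>) powr (p - 1) * ln (hi / lo)))"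
      using ji \<tau> lo_pos lo_le_hi by (intro emeasure_randomness_keep) (auto simp: v_def)
    also have "Lam / \<tau> * ((32 * real k * real v / \<tau>) powr (p - 1) * ln (hi / lo)) =
       Lam * ln (hi / lo) * (32 * real k * real v) powr (p - 1) / \<tau> powr p"
    proof -
      have "\<tau> powr p = \<tau> * \<tau> powr (p - 1)"
        using \<tau> powr_mult_base[of \<tau> "p - 1"] by simp
      then show ?thesis
        using \<tau> k_ge_1 by (simp add: powr_divide)
    qed
    also have "\<dots> = message_rate * (real v powr (p - 1) / moment S)"
      unfolding \<tau>(2) message_rate_def using k_ge_1 by (simp add: powr_mult)
    finally show "emeasure (randomness n k) ?K \<le> ennreal (message_rate * (real v powr (p - 1) / moment S))" .
  qed
  also have "\<dots> = ennreal (range_failure + accuracy_failure + exp (- \<theta>) +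
       message_rate * (real v powr (p - 1) / moment S))"
    using lo_pos message_rate_nonneg H
    by (simp add: range_failure_def accuracy_failure_def)
  finally show ?thesis
    unfolding v_def .
qed

text \<open>The leading 1 pays for the first update, before which the moment is zero and has no
  useful logarithm.\<close>

lemma nn_integral_length_hist:
  assumes "set S \<subseteq> {..<k} \<times> {..<n}" "length S \<le> m"
  shows "(\<integral>\<^sup>+\<omega>. of_nat (length (hist (fst \<omega>) (fst (snd \<omega>)) S)) \<partial>randomness n k) \<le>
     ennreal (1 + real (length S) * (range_failure + accuracy_failure + exp (- \<theta>)) +
        message_rate * 2 powr p * (if S = [] then 0 else ln (moment S)))"
  using assms
proof (induction S rule: rev_induct)
  case (snoc u S)
  interpret prob_space "randomness n k"
    by (rule prob_space_randomness)
  define \<beta> where "\<beta> = range_failure + accuracy_failure + exp (- \<theta>)"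
  have \<beta>: "0 \<le> \<beta>"
    using lo_pos by (auto simp: \<beta>_def range_failure_def accuracy_failure_def)
  have u: "u \<in> {..<k} \<times> {..<n}" and S: "set S \<subseteq> {..<k} \<times> {..<n}" "length S \<le> m"
    using snoc.prems by auto
  let ?len = "\<lambda>\<omega>. of_nat (length (hist (fst \<omega>) (fst (snd \<omega>)) S)) :: ennreal"
  let ?s = "{\<omega> \<in> space (randomness n k). sends (fst \<omega>) (fst (snd \<omega>)) S u}"
  have sets: "?s \<in> sets (randomness n k)"
    using pred_sends[OF S(1) u] by measurable
  have meas: "?len \<in> borel_measurable (randomness n k)"
    by (rule measurable_compose[OF measurable_randomness_hist[OF S(1)]]) simp
  have "(\<integral>\<^sup>+\<omega>. of_nat (length (hist (fst \<omega>) (fst (snd \<omega>)) (S @ [u]))) \<partial>randomness n k) =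
      (\<integral>\<^sup>+\<omega>. ?len \<omega> + indicator ?s \<omega> \<partial>randomness n k)"
    by (intro nn_integral_cong) (auto simp: hist_snoc)
  also have "\<dots> = (\<integral>\<^sup>+\<omega>. ?len \<omega> \<partial>randomness n k) + emeasure (randomness n k) ?s"
    using meas sets by (subst nn_integral_add) auto
  finally have eq: "(\<integral>\<^sup>+\<omega>. of_nat (length (hist (fst \<omega>) (fst (snd \<omega>)) (S @ [u]))) \<partial>randomness n k) =
      (\<integral>\<^sup>+\<omega>. ?len \<omega> \<partial>randomness n k) + emeasure (randomness n k) ?s" .
  show ?case
  proof (cases "S = []")
    case True
    have "emeasure (randomness n k) ?s \<le> 1"
      by (rule emeasure_le_1)
    also have "1 \<le> ennreal (1 + \<beta>)"
      using \<beta> by simp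
    finally have "emeasure (randomness n k) ?s \<le> ennreal (1 + \<beta>)" .
    moreover have "moment ([] @ [u]) = 1"
      using u p_ge_1 by (subst moment_snoc) auto
    moreover have "(\<integral>\<^sup>+\<omega>. ?len \<omega> \<partial>randomness n k) = 0"
      using True by simp
    ultimately show ?thesis
      unfolding eq using True by (simp only: \<beta>_def append_Nil list.size mult_1 add_0 ln_one) simp
  next
    case False
    have "emeasure (randomness n k) ?s \<le> ennreal (\<beta> + message_rate * (real (Suc (count_list S u)) powr (p - 1) / moment S))"
      unfolding \<beta>_def by (rule emeasure_sends[OF S(1) False S(2) u])
    also have "\<dots> \<le> ennreal (\<beta> + message_rate * (2 powr p * (ln (moment (S @ [u])) - ln (moment S))))"
      by (intro ennreal_leI add_left_mono mult_left_mono count_powr_le_ln_moment[OF S(1) False u] message_rate_nonneg)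
    finally have "(\<integral>\<^sup>+\<omega>. ?len \<omega> \<partial>randomness n k) + emeasure (randomness n k) ?s \<le>
        ennreal (1 + real (length S) * \<beta> + message_rate * 2 powr p * ln (moment S)) +
        ennreal (\<beta> + message_rate * (2 powr p * (ln (moment (S @ [u])) - ln (moment S))))"
      using snoc.IH[OF S] False by (intro add_mono) (simp_all add: \<beta>_def)
    also have "\<dots> = ennreal ((1 + real (length S) * \<beta> + message_rate * 2 powr p * ln (moment S)) +
        (\<beta> + message_rate * (2 powr p * (ln (moment (S @ [u])) - ln (moment S)))))"
      using \<beta> message_rate_nonneg moment_ge_1[OF S(1) False] moment_mono[OF u, of S]
      by (intro ennreal_plus[symmetric]) (auto intro!: add_nonneg_nonneg mult_nonneg_nonneg)
    also have "\<dots> = ennreal (1 + real (length (S @ [u])) * \<beta> + message_rate * 2 powr p * ln (moment (S @ [u])))"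
      by (simp add: algebra_simps)
    finally show ?thesis
      unfolding eq by (simp add: \<beta>_def)
  qed
qed simp

lemma total_bits_eq:
  assumes "set S \<subseteq> {..<k} \<times> {..<n}"
  shows "total_bits k tracking_protocol S \<omega> = of_nat (bits (fst \<omega>) (hist (fst \<omega>) (fst (snd \<omega>)) S))"
  using run_Some[OF assms, of "fst \<omega>" "fst (snd \<omega>)" "snd (snd \<omega>)"] by (cases \<omega>) (auto simp: total_bits_def)

lemma measurable_total_bits:
  assumes "set S \<subseteq> {..<k} \<times> {..<n}"
  shows "total_bits k tracking_protocol S \<in> borel_measurable (randomness n k)"
proof -
  have "(\<lambda>\<omega>. bits (fst \<omega>) (hist (fst \<omega>) (fst (snd \<omega>)) S)) \<in> measurable (randomness n k) (count_space UNIV)"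
    by (intro measurable_bits measurable_randomness_exponential measurable_randomness_tape assms)
  then show ?thesis
    unfolding total_bits_eq[OF assms, abs_def] by (rule measurable_compose) simp
qed

text \<open>Only the number of reports is random here; broadcasts cost at most
  \<open>k * A\<^sup>2\<close> bits on every sample, as at most \<open>A\<close> rises occur, each
  costing at most \<open>k * A\<close>.\<close>

lemma nn_integral_total_bits:
  assumes S: "set S \<subseteq> {..<k} \<times> {..<n}" "length S \<le> m" and m: "m \<ge> 1"
  shows "(\<integral>\<^sup>+\<omega>. total_bits k tracking_protocol S \<omega> \<partial>randomness n k) \<le>
     ennreal (real L * (1 + real m * (range_failure + accuracy_failure + exp (- \<theta>)) +
        message_rate * 2 powr p * (p * ln (real m))) + real k * (real A)\<^sup>2)"
proof -
  interpret prob_space "randomness n k"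
    by (rule prob_space_randomness)
  define \<beta> where "\<beta> = range_failure + accuracy_failure + exp (- \<theta>)"
  have \<beta>: "0 \<le> \<beta>"
    using lo_pos by (auto simp: \<beta>_def range_failure_def accuracy_failure_def)
  define E where "E = 1 + real m * \<beta> + message_rate * 2 powr p * (p * ln (real m))"
  have E: "0 \<le> E"
    using \<beta> message_rate_nonneg m p_ge_1 by (auto simp: E_def intro!: add_nonneg_nonneg mult_nonneg_nonneg)
  let ?len = "\<lambda>\<omega>. of_nat (length (hist (fst \<omega>) (fst (snd \<omega>)) S)) :: ennreal"
  have meas: "?len \<in> borel_measurable (randomness n k)"
    by (rule measurable_compose[OF measurable_randomness_hist[OF S(1)]]) simp
  have ln: "(if S = [] then 0 else ln (moment S)) \<le> p * ln (real m)"
  proof (cases "S = []")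
    case False
    have "moment S \<le> real m powr p"
      using S(2) p_ge_1 by (intro order.trans[OF moment_le_length[OF S(1)] powr_mono2]) auto
    moreover have "1 \<le> moment S"
      using moment_ge_1[OF S(1) False] .
    ultimately have "ln (moment S) \<le> ln (real m powr p)"
      using m by (subst ln_le_cancel_iff) auto
    then show ?thesis
      using False m by (simp add: ln_powr)
  qed (use m p_ge_1 in simp)
  have "(\<integral>\<^sup>+\<omega>. ?len \<omega> \<partial>randomness n k) \<le> ennreal (1 + real (length S) * \<beta> +
        message_rate * 2 powr p * (if S = [] then 0 else ln (moment S)))"
    unfolding \<beta>_def by (rule nn_integral_length_hist[OF S])
  also have "\<dots> \<le> ennreal E"
    unfolding E_def using S \<beta> ln message_rate_nonneg
    by (intro ennreal_leI add_mono mult_right_mono mult_left_mono order_refl) auto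
  finally have len: "(\<integral>\<^sup>+\<omega>. ?len \<omega> \<partial>randomness n k) \<le> ennreal E" .
  have "(\<integral>\<^sup>+\<omega>. total_bits k tracking_protocol S \<omega> \<partial>randomness n k) \<le>
      (\<integral>\<^sup>+\<omega>. of_nat L * ?len \<omega> + of_nat (k * A\<^sup>2) \<partial>randomness n k)"
  proof (intro nn_integral_mono)
    fix \<omega> :: sample
    let ?h = "hist (fst \<omega>) (fst (snd \<omega>)) S"
    have "bits (fst \<omega>) ?h \<le> L * length ?h + k * A * level (fst \<omega>) ?h"
      using set_hist by (intro bits_le) auto
    also have "\<dots> \<le> L * length ?h + k * A * A"
      by (intro add_left_mono mult_left_mono level_le) simp
    finally have "bits (fst \<omega>) ?h \<le> L * length ?h + k * A\<^sup>2"
      by (simp add: power2_eq_square)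
    then have "(of_nat (bits (fst \<omega>) ?h) :: ennreal) \<le> of_nat (L * length ?h + k * A\<^sup>2)"
      by (rule of_nat_mono)
    then show "total_bits k tracking_protocol S \<omega> \<le> of_nat L * ?len \<omega> + of_nat (k * A\<^sup>2)"
      unfolding total_bits_eq[OF S(1)] by simp
  qed
  also have "\<dots> = of_nat L * (\<integral>\<^sup>+\<omega>. ?len \<omega> \<partial>randomness n k) + of_nat (k * A\<^sup>2)"
    using meas by (simp add: nn_integral_add nn_integral_cmult emeasure_space_1 del: of_nat_mult)
  also have "\<dots> \<le> of_nat L * ennreal E + of_nat (k * A\<^sup>2)"
    by (intro add_right_mono mult_left_mono len) simp
  also have "\<dots> = ennreal (real L * E + real k * (real A)\<^sup>2)"
  proof -
    have "of_nat (k * A\<^sup>2) = ennreal (real k * (real A)\<^sup>2)"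
      by (metis ennreal_of_nat_eq_real_of_nat of_nat_mult of_nat_power)
    then show ?thesis
      using E by (simp add: ennreal_mult ennreal_of_nat_eq_real_of_nat)
  qed
  finally show ?thesis
    unfolding E_def \<beta>_def .
qed

end

section \<open>Choice of the parameters\<close>

lemma ex_fixed_length_encoding:
  assumes "finite X" "card X \<le> 2 ^ L"
  shows "\<exists>enc :: 'a \<Rightarrow> bool list. inj_on enc X \<and> (\<forall>x. length (enc x) = L)"
proof -
  let ?B = "{bs :: bool list. length bs = L}"
  have "card ?B = 2 ^ L" "finite ?B"
    using card_lists_length_eq[of "UNIV :: bool set" L] finite_lists_length_eq[of "UNIV :: bool set" L] by simp_all
  then obtain f where f: "f ` X \<subseteq> ?B" "inj_on f X"
    using card_le_inj[of X ?B] assms by auto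
  \<comment> \<open>Arguments outside \<open>X\<close> get a dummy string, because the length is
    required of every argument.\<close>
  define enc where "enc = (\<lambda>x. if x \<in> X then f x else replicate L True)"
  have "inj_on enc X"
    using f by (auto simp: enc_def inj_on_def)
  moreover have "length (enc x) = L" for x
    using f by (auto simp: enc_def)
  ultimately show ?thesis
    by blast
qed

lemma nat_ceiling_log2:
  fixes n :: nat
  assumes "n \<ge> 2"
  defines "l \<equiv> nat \<lceil>log 2 (real n)\<rceil>"
  shows "real n \<le> 2 ^ l" "1 \<le> l" "l \<le> n" "real l \<le> 2 * log 2 (real n)"
proof -
  have log: "1 \<le> log 2 (real n)"
    using assms by (subst le_log_iff) auto
  have l: "log 2 (real n) \<le> real l" "real l < log 2 (real n) + 1"
    using log unfolding l_def by linarith+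
  show "real l \<le> 2 * log 2 (real n)"
    using l log by linarith
  show "1 \<le> l"
    using l log by linarith
  have "real n = 2 powr log 2 (real n)"
    using assms by simp
  also have "\<dots> \<le> 2 powr real l"
    using l by (intro powr_mono) auto
  finally show "real n \<le> 2 ^ l"
    by (simp add: powr_realpow)
  have "log 2 (real n) \<le> log 2 (2 ^ n)"
    using assms of_nat_less_two_power[of n, where 'a = real] by (subst log_le_cancel_iff) (auto simp: less_imp_le)
  then have "log 2 (real n) \<le> real n"
    by (simp add: log_nat_power)
  then show "l \<le> n"
    by (simp add: l_def nat_le_iff ceiling_le_iff)
qed

lemma le_power_self: "2 \<le> n \<Longrightarrow> q \<le> n ^ q" for n q :: nat
  by (rule order.trans[OF less_imp_le[OF less_exp] power_mono]) auto

text \<open>Weights lie between \<open>n ^ (- D)\<close> and \<open>n ^ D\<close>, so scaled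
  frequencies are at most \<open>n ^ (c + D)\<close>. Since \<open>2 ^ (q * l)\<close> is at least
  \<open>n ^ q\<close>, the top threshold is at least \<open>n ^ (c + D + 1)\<close>, where the
  extra factor \<open>n\<close> covers the 2 in \<open>thr A / 2\<close>. A report encodes one of at
  most \<open>n ^ (q + 3)\<close> pairs.\<close>

lemma ex_calibrated_tracker:
  fixes p :: real and c d n k :: nat
  assumes p: "p \<ge> 1" and n: "n \<ge> 2" and k: "k \<ge> 1"
  defines "D \<equiv> c + d + 3" defines "q \<equiv> c + 2 * D + 1" defines "l \<equiv> nat \<lceil>log 2 (real n)\<rceil>"
  shows "\<exists>enc. calibrated_tracker p (1024 * real (c + q + d + 5) * ln (real n)) (1 / real n ^ D) n k
     (q * l) ((q + 3) * l) enc (1 / real n ^ D) (real n ^ D) (real D * ln (real n)) (n ^ c)"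
proof -
  have n_le: "real n \<le> 2 ^ l" and l_1: "1 \<le> l" and l_le: "l \<le> n"
    using nat_ceiling_log2[OF n] by (simp_all add: l_def)
  have n_le_nat: "n \<le> 2 ^ l"
    using n_le by (metis of_nat_le_iff of_nat_numeral of_nat_power)
  have "q * l \<le> n ^ q * n"
    using l_le le_power_self[OF n] by (intro mult_mono) auto
  then have A: "q * l \<le> n ^ (q + 1)"
    by (simp add: mult.commute)
  have "card ({..<n} \<times> {..q * l}) = n * Suc (q * l)"
    by (simp add: card_cartesian_product)
  also have "\<dots> \<le> n * (n ^ (q + 1) * n)"
  proof (rule mult_left_mono)
    have "1 \<le> n ^ (q + 1)"
      using n by simp
    then have "Suc (q * l) \<le> n ^ (q + 1) * 2"
      using A by linarith
    also have "\<dots> \<le> n ^ (q + 1) * n"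
      using n by (intro mult_left_mono) auto
    finally show "Suc (q * l) \<le> n ^ (q + 1) * n" .
  qed simp
  also have "\<dots> = n ^ (q + 3)"
    by (simp add: power_add power3_eq_cube)
  also have "\<dots> \<le> (2 ^ l) ^ (q + 3)"
    by (intro power_mono n_le_nat) simp
  also have "\<dots> = 2 ^ ((q + 3) * l)"
    by (simp add: power_mult[symmetric] mult.commute)
  finally obtain enc :: "nat \<times> nat \<Rightarrow> bool list" where
    enc: "inj_on enc ({..<n} \<times> {..q * l})" "\<And>x. length (enc x) = (q + 3) * l"
    using ex_fixed_length_encoding[of "{..<n} \<times> {..q * l}" "(q + 3) * l"] by auto
  have powr_le: "y powr (1 / p) \<le> real n ^ D" if "0 \<le> y" "y \<le> real n ^ D" for y
  proof -
    have "y powr (1 / p) \<le> (real n ^ D) powr (1 / p)"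
      using that p by (intro powr_mono2) auto
    also have "\<dots> \<le> (real n ^ D) powr 1"
      using p n by (intro powr_mono) auto
    also have "\<dots> = real n ^ D"
      using n by simp
    finally show ?thesis .
  qed
  have tracker: "tracker p (1024 * real (c + q + d + 5) * ln (real n)) (1 / real n ^ D) n k
     (q * l) ((q + 3) * l) enc"
  proof
    show "1024 * real (c + q + d + 5) * ln (real n) > 0"
      using n by auto
    show "q * l > 0" "(q + 3) * l > 0"
      using l_1 by (auto simp: q_def)
  qed (use p n k enc in auto)
  have "calibrated_tracker p (1024 * real (c + q + d + 5) * ln (real n)) (1 / real n ^ D) n k
     (q * l) ((q + 3) * l) enc (1 / real n ^ D) (real n ^ D) (real D * ln (real n)) (n ^ c)"
  proof (intro calibrated_tracker.intro calibrated_tracker_axioms.intro tracker)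
    show "0 < 1 / real n ^ D" "real D * ln (real n) > 0"
      using n by (auto simp: D_def)
    show "1 / real n ^ D \<le> real n ^ D"
      using n by (simp add: order.trans[of _ 1])
    fix x :: real
    assume x: "1 / real n ^ D \<le> x" "x \<le> real n ^ D"
    have x_pos: "x > 0"
      using x n by (intro less_le_trans[OF _ x(1)]) simp
    show "1 / real n ^ D \<le> 1 / x powr (1 / p)"
      using powr_le[of x] x x_pos n by (intro divide_left_mono) auto
    have "1 / x \<le> real n ^ D"
      using x x_pos n by (simp add: field_simps)
    then have "1 / x powr (1 / p) \<le> real n ^ D"
      using powr_le[of "1 / x"] x_pos by (simp add: powr_divide)
    then have "real (n ^ c) * (1 / x powr (1 / p)) \<le> real n ^ c * real n ^ D"
      unfolding of_nat_power by (rule mult_left_mono) simp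
    also have "\<dots> = real n ^ (c + 2 * D) * 2 / (2 * real n ^ D)"
    proof -
      have "real n ^ (c + 2 * D) = real n ^ c * real n ^ D * real n ^ D"
        by (simp only: power_add mult_2 mult.assoc)
      moreover have "real n ^ D > 0"
        using n by simp
      ultimately show ?thesis
        by simp
    qed
    also have "\<dots> \<le> real n ^ (c + 2 * D) * real n / (2 * real n ^ D)"
      using n by (intro divide_right_mono mult_left_mono) auto
    also have "\<dots> = real n ^ q / (2 * real n ^ D)"
      by (simp add: q_def)
    also have "\<dots> \<le> (2 ^ l) ^ q / (2 * real n ^ D)"
      by (intro divide_right_mono power_mono n_le) auto
    also have "\<dots> = tracker.thr (1 / real n ^ D) (q * l) / 2"
      by (simp add: tracker.thr_def[OF tracker] power_mult[symmetric] mult.commute)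
    finally show "real (n ^ c) * (1 / x powr (1 / p)) \<le> tracker.thr (1 / real n ^ D) (q * l) / 2" .
  qed
  then show ?thesis
    by blast
qed

theorem mainTheorem5:
  fixes p :: real and c d :: nat
  assumes "p \<ge> 1"
  shows "\<exists>(A::real) (B::nat). \<forall>n\<ge>2. \<forall>k\<ge>1. \<exists>P :: protocol.
           \<forall>S \<in> streams_over n k. length S \<le> n ^ c \<longrightarrow>
             {\<omega> \<in> space (randomness n k). correct_always p n k P S \<omega>} \<in> sets (randomness n k) \<and>
             measure (randomness n k)
               {\<omega> \<in> space (randomness n k). correct_always p n k P S \<omega>} \<ge> 1 - 1 / real n ^ d \<and>
             total_bits k P S \<in> borel_measurable (randomness n k) \<and>
             (\<integral>\<^sup>+\<omega>. total_bits k P S \<omega> \<partial>randomness n k)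
               \<le> ennreal (A * (real k + real k powr (p - 1)) * ln (real n) ^ B)"
proof -
  \<comment> \<open>The range failure is at most \<open>2 * n / n ^ D\<close>; this exponent keeps
    it below \<open>1 / n ^ (c + d + 1)\<close>, small even when multiplied by the number of
    updates.\<close>
  define D where "D = c + d + 3"
  define q where "q = c + 2 * D + 1"
  \<comment> \<open>Here \<open>exp (- Lam / 1024) = 1 / n ^ D'\<close>. The union over
    \<open>n\<close> coordinates and at most \<open>n ^ (q + 1)\<close> levels, and the factor 2,
    cost \<open>n ^ (q + 3)\<close>; \<open>1 / n ^ (c + d + 2)\<close> is left.\<close>
  define D' where "D' = c + q + d + 5"
  \<comment> \<open>The constants of \<open>message_rate\<close> and of the factor
    \<open>2 powr p * (p * ln m)\<close>, after extracting four logarithms: from \<open>Lam\<close>,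
    \<open>\<theta>\<close>, \<open>ln (hi / lo)\<close> and \<open>ln m\<close>.\<close>
  define C where "C = 2048 * real D' * (real D)\<^sup>2 * 32 powr (p - 1) * 4 powr p * 2 powr p * p * real c"
  define K where "K = 8 * real (q + 3) + 2 * real (q + 3) * C + 4 * (real q)\<^sup>2"
  have C: "0 \<le> C"
    using assms by (simp add: C_def)
  show ?thesis
  proof (intro exI[of _ "K / ln 2 ^ 5"] exI[of _ 5] allI impI)
    fix n k :: nat assume n: "n \<ge> 2" and k: "k \<ge> 1"
    define l where "l = nat \<lceil>log 2 (real n)\<rceil>"
    note log = nat_ceiling_log2[OF n, folded l_def]
    obtain enc where "calibrated_tracker p (1024 * real D' * ln (real n)) (1 / real n ^ D) n k
       (q * l) ((q + 3) * l) enc (1 / real n ^ D) (real n ^ D) (real D * ln (real n)) (n ^ c)"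
      using ex_calibrated_tracker[OF assms n k, of c d] unfolding D_def D'_def q_def l_def by blast
    then interpret calibrated_tracker p "1024 * real D' * ln (real n)" "1 / real n ^ D" n k
       "q * l" "(q + 3) * l" enc "1 / real n ^ D" "real n ^ D" "real D * ln (real n)" "n ^ c" .
    have two_le: "2 \<le> real n"
      using n by simp
    have inv_power: "exp (- (real x * ln (real n))) = 1 / real n ^ x" for x
      using n by (simp add: exp_minus exp_of_nat_mult field_simps)
    have inv_power_mono: "1 / real n ^ y \<le> 1 / real n ^ x" if "x \<le> y" for x y
      using n that by (intro divide_left_mono power_increasing) auto
    have range: "range_failure \<le> 1 / real n ^ (c + d + 1)"
    proof -
      have "exp (- (real n ^ D)) \<le> 1 / real n ^ D"
      proof -
        have "real n ^ D \<le> exp (real n ^ D)"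
          using exp_ge_add_one_self[of "real n ^ D"] by linarith
        then have "1 / exp (real n ^ D) \<le> 1 / real n ^ D"
          using n by (intro divide_left_mono) auto
        then show ?thesis
          by (simp add: exp_minus inverse_eq_divide)
      qed
      then have "range_failure \<le> real n * (1 / real n ^ D + 1 / real n ^ D)"
        unfolding range_failure_def by (intro mult_left_mono) auto
      also have "\<dots> = 2 * real n / real n ^ D"
        by simp
      also have "\<dots> \<le> real n * real n / real n ^ D"
        using two_le by (intro divide_right_mono mult_right_mono) auto
      also have "\<dots> = 1 / real n ^ (c + d + 1)"
        using n by (simp add: D_def power_add power3_eq_cube field_simps)
      finally show ?thesis .
    qed
    have acc: "accuracy_failure \<le> 1 / real n ^ (c + d + 2)"
    proof -
      have "real q \<le> real n ^ q"
        using le_power_self[OF n, of q] by (metis of_nat_le_iff of_nat_power)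
      then have "real (q * l) \<le> real n ^ q * real n"
        using log(3) by (simp add: mult_mono)
      then have "accuracy_failure \<le> real n * (real n ^ q * real n * (real n * (1 / real n ^ D')))"
        unfolding accuracy_failure_def using two_le inv_power[of D']
        by (intro mult_left_mono mult_mono) (auto simp: mult.assoc)
      also have "\<dots> = 1 / real n ^ (c + d + 2)"
        using n by (simp add: D'_def power_add power_numeral_reduce field_simps)
      finally show ?thesis .
    qed
    have nc: "real (Suc (n ^ c)) \<le> real n ^ (c + 1)"
    proof -
      have "1 \<le> real n ^ c"
        using n by simp
      then have "real (Suc (n ^ c)) \<le> 2 * real n ^ c"
        by simp
      also have "\<dots> \<le> real n * real n ^ c"
        using two_le by (intro mult_right_mono) auto
      finally show ?thesis
        by simp
    qed
    have acc_nonneg: "0 \<le> accuracy_failure" and range_nonneg: "0 \<le> range_failure"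
      by (simp_all add: accuracy_failure_def range_failure_def)
    have failure: "range_failure + real (Suc (n ^ c)) * accuracy_failure \<le> 1 / real n ^ d"
    proof -
      have "real (Suc (n ^ c)) * accuracy_failure \<le> real n ^ (c + 1) * (1 / real n ^ (c + d + 2))"
        using acc nc acc_nonneg by (intro mult_mono) auto
      also have "\<dots> = 1 / real n ^ (d + 1)"
        using n by (simp add: power_add field_simps power2_eq_square)
      finally have "range_failure + real (Suc (n ^ c)) * accuracy_failure \<le> 1 / real n ^ (d + 1) + 1 / real n ^ (d + 1)"
        using range inv_power_mono[of "d + 1" "c + d + 1"] by linarith
      also have "\<dots> = 2 / real n * (1 / real n ^ d)"
        by simp
      also have "\<dots> \<le> 1 * (1 / real n ^ d)"
        using two_le by (intro mult_right_mono) auto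
      finally show ?thesis
        by simp
    qed
    \<comment> \<open>Binary logarithms satisfy \<open>1 \<le> x\<close> even for
      \<open>n = 2\<close>, so lower powers of \<open>x\<close> are dominated by
      \<open>x ^ 5\<close>; returning to \<open>ln\<close> costs \<open>ln 2 ^ 5\<close>.\<close>
    define x where "x = log 2 (real n)"
    have x_ge: "1 \<le> x"
      unfolding x_def using n by (subst le_log_iff) auto
    have x_eq: "x = ln (real n) / ln 2"
      by (simp add: x_def log_def)
    have ln2: "0 < ln (2::real)" "ln (2::real) \<le> 1"
      using ln_le_minus_one[of "2::real"] by auto
    have ln_le: "ln (real n) \<le> x"
      using ln2 n by (simp add: x_eq field_simps mult_left_le)
    have ln_nonneg: "0 \<le> ln (real n)"
      using n by simp
    have l: "real l \<le> 2 * x"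
      unfolding x_def by (rule log(4))
    \<comment> \<open>A failure may cause a report at every update, but its probability per update
      is of order \<open>1 / n ^ c\<close>, which adds a constant to the expected number of
      reports.\<close>
    have small: "real (n ^ c) * (range_failure + accuracy_failure + exp (- (real D * ln (real n)))) \<le> 3"
    proof -
      have "range_failure + accuracy_failure + exp (- (real D * ln (real n))) \<le> 3 * (1 / real n ^ c)"
        using range acc inv_power_mono[of c "c + d + 1"] inv_power_mono[of c "c + d + 2"] inv_power_mono[of c D]
        unfolding inv_power by (simp add: D_def)
      then have "real (n ^ c) * (range_failure + accuracy_failure + exp (- (real D * ln (real n)))) \<le>
          real (n ^ c) * (3 * (1 / real n ^ c))"
        by (intro mult_left_mono) auto
      then show ?thesis
        using n by simp
    qed
    have rate: "message_rate * 2 powr p * (p * ln (real (n ^ c))) \<le> C * x ^ 4 * real k powr (p - 1)"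
    proof -
      have "ln (real n ^ D / (1 / real n ^ D)) = 2 * real D * ln (real n)"
        using n by (simp add: ln_mult ln_realpow)
      then have "message_rate * 2 powr p * (p * ln (real (n ^ c))) = C * ln (real n) ^ 4 * real k powr (p - 1)"
        using n by (simp add: message_rate_def C_def ln_realpow power2_eq_square power4_eq_xxxx)
      also have "\<dots> \<le> C * x ^ 4 * real k powr (p - 1)"
        using C ln_le ln_nonneg by (intro mult_right_mono mult_left_mono power_mono) auto
      finally show ?thesis .
    qed
    have bits: "real ((q + 3) * l) * (1 + real (n ^ c) * (range_failure + accuracy_failure + exp (- (real D * ln (real n)))) +
        message_rate * 2 powr p * (p * ln (real (n ^ c)))) + real k * (real (q * l))\<^sup>2
        \<le> K / ln 2 ^ 5 * (real k + real k powr (p - 1)) * ln (real n) ^ 5"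
      (is "?lhs \<le> _")
    proof -
      let ?r = "real k powr (p - 1)"
      have r: "0 \<le> ?r" "1 \<le> real k"
        using k by auto
      have pow: "x ^ i \<le> x ^ 5" if "i \<le> 5" for i
        using x_ge that by (intro power_increasing) auto
      have "?lhs \<le> real (q + 3) * (2 * x) * (4 + C * x ^ 4 * ?r) + real k * (real q * (2 * x))\<^sup>2"
      proof (rule add_mono)
        have "real ((q + 3) * l) \<le> real (q + 3) * (2 * x)"
          unfolding of_nat_mult using l by (intro mult_left_mono) auto
        moreover have "1 + real (n ^ c) * (range_failure + accuracy_failure + exp (- (real D * ln (real n)))) +
            message_rate * 2 powr p * (p * ln (real (n ^ c))) \<le> 4 + C * x ^ 4 * ?r"
          using small rate by linarith
        moreover have "0 \<le> 4 + C * x ^ 4 * ?r"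
          using C x_ge by (intro add_nonneg_nonneg mult_nonneg_nonneg) auto
        ultimately show "real ((q + 3) * l) * (1 + real (n ^ c) * (range_failure + accuracy_failure +
            exp (- (real D * ln (real n)))) + message_rate * 2 powr p * (p * ln (real (n ^ c))))
            \<le> real (q + 3) * (2 * x) * (4 + C * x ^ 4 * ?r)"
          by (intro order.trans[OF mult_left_mono mult_right_mono]) auto
        show "real k * (real (q * l))\<^sup>2 \<le> real k * (real q * (2 * x))\<^sup>2"
          unfolding of_nat_mult using l by (intro mult_left_mono power_mono) auto
      qed
      also have "\<dots> = 8 * real (q + 3) * x ^ 1 + 2 * real (q + 3) * C * (x ^ 5 * ?r) + 4 * (real q)\<^sup>2 * (real k * x ^ 2)"
        by (simp add: algebra_simps power2_eq_square power_numeral_reduce)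
      also have "\<dots> \<le> 8 * real (q + 3) * (x ^ 5 * (real k + ?r)) + 2 * real (q + 3) * C * (x ^ 5 * (real k + ?r)) +
          4 * (real q)\<^sup>2 * (x ^ 5 * (real k + ?r))"
      proof (intro add_mono mult_left_mono)
        have "1 \<le> real k + ?r"
          using r by linarith
        then have "x ^ 1 * 1 \<le> x ^ 5 * (real k + ?r)"
          using x_ge by (intro mult_mono[OF pow]) auto
        then show "x ^ 1 \<le> x ^ 5 * (real k + ?r)"
          by simp
        show "real k * x ^ 2 \<le> x ^ 5 * (real k + ?r)"
          using mult_mono[OF pow[of 2], of "real k" "real k + ?r"] r x_ge by (simp add: mult.commute)
        show "?r \<le> real k + ?r"
          using r by simp
      qed (use C x_ge in auto)
      also have "\<dots> = K * (real k + ?r) * x ^ 5"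
        by (simp add: K_def algebra_simps)
      also have "\<dots> = K / ln 2 ^ 5 * (real k + ?r) * ln (real n) ^ 5"
        by (simp add: x_eq power_divide)
      finally show ?thesis .
    qed
    show "\<exists>P. \<forall>S \<in> streams_over n k. length S \<le> n ^ c \<longrightarrow>
             {\<omega> \<in> space (randomness n k). correct_always p n k P S \<omega>} \<in> sets (randomness n k) \<and>
             measure (randomness n k)
               {\<omega> \<in> space (randomness n k). correct_always p n k P S \<omega>} \<ge> 1 - 1 / real n ^ d \<and>
             total_bits k P S \<in> borel_measurable (randomness n k) \<and>
             (\<integral>\<^sup>+\<omega>. total_bits k P S \<omega> \<partial>randomness n k)
               \<le> ennreal (K / ln 2 ^ 5 * (real k + real k powr (p - 1)) * ln (real n) ^ 5)"
    proof (intro exI[of _ tracking_protocol] ballI impI conjI)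
      fix S assume "S \<in> streams_over n k" and len: "length S \<le> n ^ c"
      then have S: "set S \<subseteq> {..<k} \<times> {..<n}"
        by (simp add: streams_over_def)
      show "{\<omega> \<in> space (randomness n k). correct_always p n k tracking_protocol S \<omega>} \<in> sets (randomness n k)"
        by (rule sets_correct_always[OF S])
      show "1 - 1 / real n ^ d \<le> measure (randomness n k)
          {\<omega> \<in> space (randomness n k). correct_always p n k tracking_protocol S \<omega>}"
        using measure_correct_always[OF S len] failure by linarith
      show "total_bits k tracking_protocol S \<in> borel_measurable (randomness n k)"
        by (rule measurable_total_bits[OF S])
      have "1 \<le> n ^ c"
        using n by simp
      from order.trans[OF nn_integral_total_bits[OF S len this] ennreal_leI[OF bits]]
      show "(\<integral>\<^sup>+\<omega>. total_bits k tracking_protocol S \<omega> \<partial>randomness n k) \<le>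
          ennreal (K / ln 2 ^ 5 * (real k + real k powr (p - 1)) * ln (real n) ^ 5)" .
    qed
  qed
qed

end
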